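(* Let $a>0$ and let $\tilde X: I\subset\mathbb{R}\to Q^2_+$, $\tilde X(s)=(\tilde x_1(s),\tilde x_2(s),\tilde x_3(s))$, $0\in I$, be a soliton solution to the inverse curvature flow (ICF) in $Q^2_+$, parametrized by arc length, that corresponds to a solution $\tilde\psi(s)=(\tilde\alpha(s),\tilde\tau(s),\tilde\eta(s))$ of the system $$\tilde\alpha'=\tilde\tau,\qquad \tilde\tau'=\frac{\tilde\alpha}{a\tilde\tau}-\tilde\eta,\qquad \tilde\eta'=-\frac1a,$$ with $\tilde\psi(0)\in C$. Then $-\tilde Y(s)$ is a soliton solution to the curvature flow (CF) in $Q^2_+$, where $\tilde Y(s)=(\tilde y_1(s),\tilde y_2(s),\tilde y_3(s))$ is the associated curve of $\tilde X(s)$, and for $s<a\tilde\eta_0$, where $\tilde\eta_0=\tilde\eta(0)>0$ and $\tilde\tau_0=\tilde\tau(0)$, we have $$\tilde X=\left(-\frac{\tilde x_3^2+\tilde\alpha^2}{2\tilde\alpha},\ \frac{-\tilde x_3^2+\tilde\alpha^2}{2\tilde\alpha},\ \tilde x_3\right),\qquad \tilde\alpha(s)=-\frac{\tilde\tau^2(s)}{2\tilde\eta(s)},\qquad \tilde\eta(s)=-\frac sa+\tilde\eta_0,$$ $$\tilde Y=\left(-\frac{\tilde y_3^2+\tilde\eta^2}{2\tilde\eta},\ \frac{-\tilde y_3^2+\tilde\eta^2}{2\tilde\eta},\ \tilde y_3\right),\qquad \tilde\tau(s)=\frac{2a\tilde\eta^2(s)}{3}+\sqrt{\tilde\eta(s)}\left(\frac{3\tilde\tau_0-2a\tilde\eta_0^2}{3\sqrt{\tilde\eta_0}}\right),$$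 $$\tilde y_3(s)=\frac{\tilde\eta(s)\tilde x_3(s)+\tilde\tau(s)}{\tilde\alpha(s)},\qquad \tilde x_3(s)=\left(\tilde\eta^{3/2}(s)+D\right)^2\left(-\int(\tilde\eta^{3/2}(s)+D)^{-2}\,ds+C_0\right),$$ where $C_0$ is a constant and $D=\frac{3}{2a}\left(\frac{3\tilde\tau_0-2a\tilde\eta_0^2}{3\sqrt{\tilde\eta_0}}\right)$. Moreover, if $D>0$, then (up to an additive constant) $$\int(\tilde\eta^{3/2}(s)+D)^{-2}ds=-a\left\{\frac1{9D^{4/3}}\log\frac{\tilde\eta-D^{1/3}\left(\sqrt{\tilde\eta}-D^{1/3}\right)}{\left(\sqrt{\tilde\eta}+D^{1/3}\right)^2}+\frac{2}{3\sqrt3D^{4/3}}\left[\arctan\left(\frac{2\sqrt{\tilde\eta}-D^{1/3}}{\sqrt3D^{1/3}}\right)+\frac{\sqrt3\,\tilde\eta}{D^{-1/3}\tilde\eta^{3/2}+D^{2/3}}\right]\right\}.$$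
   Context: $\mathbb{R}^3_1$ is $\mathbb{R}^3$ with the Minkowski metric $\langle u,v\rangle=-u_1v_1+u_2v_2+u_3v_3$. The light cone is $Q^2=\{p\in\mathbb{R}^3_1\setminus\{0\}:\langle p,p\rangle=0\}$ and $Q^2_+=\{p\in Q^2:p_1>0\}$. For a (smooth) spacelike curve $X$ on $Q^2$ parametrized by arc length $s$, $T=X'$ is the unit tangent field, $Y(s)$ is the unique lightlike vector orthogonal to $T(s)$ with $\langle X(s),Y(s)\rangle=1$ (the associated curve), and the curvature $k$ is defined by $T'=kX-Y$. For an arbitrary parameter, $T,Y,k$ are those obtained via arc-length reparametrization. Curves are oriented so that $T=X\times Y$, where $X\times Y=(-(x_2y_3-x_3y_2),\,x_3y_1-x_1y_3,\,x_1y_2-x_2y_1)$ is the Lorentzian cross product. A 1-parameter family of spacelike curves $\hat X:I\times J\to Q^2_+$, $J$ an interval containing $0$, with associated curves $\hat Y^t$ and curvatures $\hat k^t$, is a solution to the CF (resp. ICF, for non-vanishing curvatures) with initial condition $X$ if $\hat X^0=X$ and $\langle \frac{\partial}{\partial t}\hat X^t,\hat Y^t\rangle=\hat k^t$ (resp. $=-1/\hat k^t$). $X$ is a soliton solution if there is a solution of the form $\hat X^t(s)=M(t)X(s)$ with $M(t)$ a smooth family of elements of $O_1(3)$ preserving $Q^2_+$, $M(0)=\mathrm{Id}$. $C=\{(\alpha,\tau,\eta)\in\mathbb{R}^3\setminus\{0\}:2\alpha\eta+\tau^2=0,\ \alpha\le0\}$. That $\tilde X$ corresponds to $\tilde\psi$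 means that, with $e=(1,1,0)$, $\tilde\alpha=\langle\tilde X,e\rangle$, $\tilde\tau=\langle\tilde T,e\rangle$, $\tilde\eta=\langle\tilde Y,e\rangle$, and the (non-vanishing) curvature $\tilde k$ of $\tilde X$ satisfies $1/\tilde k(s)=a\tilde\tau(s)$ (in particular $\tilde\tau\ne0$). *)

theory Defs
  imports "HOL-Analysis.Analysis"
begin

section \<open>Minkowski space and the light cone\<close>

definition mink :: "real^3 \<Rightarrow> real^3 \<Rightarrow> real" where
  "mink u v = - (u $ 1 * v $ 1) + u $ 2 * v $ 2 + u $ 3 * v $ 3"

definition lorentz_cross :: "real^3 \<Rightarrow> real^3 \<Rightarrow> real^3" where
  "lorentz_cross x y = vector
     [- (x $ 2 * y $ 3 - x $ 3 * y $ 2),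
      x $ 3 * y $ 1 - x $ 1 * y $ 3,
      x $ 1 * y $ 2 - x $ 2 * y $ 1]"

definition light_cone :: "(real^3) set" where
  "light_cone = {p. p \<noteq> 0 \<and> mink p p = 0}"

definition light_cone_pos :: "(real^3) set" where
  "light_cone_pos = {p \<in> light_cone. p $ 1 > 0}"

definition lorentz_matrices :: "(real^3^3) set" where
  "lorentz_matrices = {A. \<forall>u v. mink (A *v u) (A *v v) = mink u v}"

definition cone_C :: "(real \<times> real \<times> real) set" where
  "cone_C = {(\<alpha>, \<tau>, \<eta>). (\<alpha>, \<tau>, \<eta>) \<noteq> (0, 0, 0) \<and> 2 * \<alpha> * \<eta> + \<tau>\<^sup>2 = 0 \<and> \<alpha> \<le> 0}"


section \<open>Smoothness on intervals\<close>

text \<open>Intervals need not be open; all derivatives are taken within the interval, hence they are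
  one-sided at an end point that belongs to it.\<close>

definition proper_interval :: "real set \<Rightarrow> bool" where
  "proper_interval I \<longleftrightarrow> is_interval I \<and> interior I \<noteq> {}"

text \<open>The witness \<open>D n\<close> is the \<open>n\<close>-th derivative.\<close>

definition smooth_on :: "real set \<Rightarrow> (real \<Rightarrow> 'a::real_normed_vector) \<Rightarrow> bool" where
  "smooth_on I f \<longleftrightarrow> (\<exists>D :: nat \<Rightarrow> real \<Rightarrow> 'a.
     (\<forall>s\<in>I. D 0 s = f s) \<and>
     (\<forall>n. \<forall>s\<in>I. (D n has_vector_derivative D (Suc n) s) (at s within I)))"

text \<open>Joint smoothness of \<open>(s, t) \<mapsto> F t s\<close>. The witness \<open>D m n\<close> is the mixed partial derivative of
  order \<open>m\<close> in \<open>s\<close> and \<open>n\<close> in \<open>t\<close>.\<close>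

definition smooth_family :: "real set \<Rightarrow> real set \<Rightarrow> (real \<Rightarrow> real \<Rightarrow> real^3) \<Rightarrow> bool" where
  "smooth_family I J F \<longleftrightarrow> (\<exists>D :: nat \<Rightarrow> nat \<Rightarrow> real \<Rightarrow> real \<Rightarrow> real^3.
     (\<forall>t\<in>J. \<forall>s\<in>I. D 0 0 t s = F t s) \<and>
     (\<forall>m n. continuous_on (I \<times> J) (\<lambda>(s, t). D m n t s)) \<and>
     (\<forall>m n. \<forall>t\<in>J. \<forall>s\<in>I.
        ((\<lambda>s. D m n t s) has_vector_derivative D (Suc m) n t s) (at s within I) \<and>
        ((\<lambda>t. D m n t s) has_vector_derivative D m (Suc n) t s) (at t within J)))"

definition antiderivative_on :: "real set \<Rightarrow> (real \<Rightarrow> real) \<Rightarrow> (real \<Rightarrow> real) \<Rightarrow> bool" where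
  "antiderivative_on S f F \<longleftrightarrow> (\<forall>s\<in>S. (F has_real_derivative f s) (at s within S))"


section \<open>Spacelike curves on the light cone\<close>

definition velocity :: "real set \<Rightarrow> (real \<Rightarrow> real^3) \<Rightarrow> real \<Rightarrow> real^3" where
  "velocity I X s = vector_derivative X (at s within I)"

definition spacelike_curve :: "real set \<Rightarrow> (real \<Rightarrow> real^3) \<Rightarrow> bool" where
  "spacelike_curve I X \<longleftrightarrow> proper_interval I \<and> smooth_on I X \<and>
     (\<forall>s\<in>I. X s \<in> light_cone \<and> mink (velocity I X s) (velocity I X s) > 0)"

definition arc_length_curve :: "real set \<Rightarrow> (real \<Rightarrow> real^3) \<Rightarrow> bool" where
  "arc_length_curve I X \<longleftrightarrow> spacelike_curve I X \<and>
     (\<forall>s\<in>I. mink (velocity I X s) (velocity I X s) = 1)"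

text \<open>The associated curve and the curvature of a curve parametrized by arc length.\<close>

definition assoc_al :: "real set \<Rightarrow> (real \<Rightarrow> real^3) \<Rightarrow> real \<Rightarrow> real^3" where
  "assoc_al I X s =
     (THE y. y \<in> light_cone \<and> mink (velocity I X s) y = 0 \<and> mink (X s) y = 1)"

definition curvature_al :: "real set \<Rightarrow> (real \<Rightarrow> real^3) \<Rightarrow> real \<Rightarrow> real" where
  "curvature_al I X s =
     (THE k. vector_derivative (velocity I X) (at s within I) = k *\<^sub>R X s - assoc_al I X s)"

text \<open>For an arbitrary parameter, the two notions are those of the arc-length reparametrization.
  They depend neither on the additive constant in the arc-length function nor on the orientation
  of the curve.\<close>

definition arc_length_fun :: "real set \<Rightarrow> (real \<Rightarrow> real^3) \<Rightarrow> real \<Rightarrow> real" where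
  "arc_length_fun I X =
     (SOME \<phi>. antiderivative_on I (\<lambda>s. sqrt (mink (velocity I X s) (velocity I X s))) \<phi>)"

definition arc_length_repar :: "real set \<Rightarrow> (real \<Rightarrow> real^3) \<Rightarrow> real \<Rightarrow> real^3" where
  "arc_length_repar I X = X \<circ> inv_into I (arc_length_fun I X)"

definition assoc_curve :: "real set \<Rightarrow> (real \<Rightarrow> real^3) \<Rightarrow> real \<Rightarrow> real^3" where
  "assoc_curve I X s =
     assoc_al (arc_length_fun I X ` I) (arc_length_repar I X) (arc_length_fun I X s)"

definition curvature :: "real set \<Rightarrow> (real \<Rightarrow> real^3) \<Rightarrow> real \<Rightarrow> real" where
  "curvature I X s =
     curvature_al (arc_length_fun I X ` I) (arc_length_repar I X) (arc_length_fun I X s)"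


section \<open>Curvature flow, inverse curvature flow and solitons\<close>

text \<open>A family is written \<open>F t s\<close>, with the flow parameter \<open>t\<close> first.\<close>

definition spacelike_family :: "real set \<Rightarrow> real set \<Rightarrow> (real \<Rightarrow> real \<Rightarrow> real^3) \<Rightarrow> bool" where
  "spacelike_family I J F \<longleftrightarrow> proper_interval J \<and> 0 \<in> J \<and> smooth_family I J F \<and>
     (\<forall>t\<in>J. spacelike_curve I (F t) \<and> (\<forall>s\<in>I. F t s \<in> light_cone_pos))"

definition CF_solution ::
    "real set \<Rightarrow> real set \<Rightarrow> (real \<Rightarrow> real \<Rightarrow> real^3) \<Rightarrow> (real \<Rightarrow> real^3) \<Rightarrow> bool" where
  "CF_solution I J F X \<longleftrightarrow> spacelike_family I J F \<and> (\<forall>s\<in>I. F 0 s = X s) \<and>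
     (\<forall>t\<in>J. \<forall>s\<in>I.
        mink (vector_derivative (\<lambda>t. F t s) (at t within J)) (assoc_curve I (F t) s)
          = curvature I (F t) s)"

definition ICF_solution ::
    "real set \<Rightarrow> real set \<Rightarrow> (real \<Rightarrow> real \<Rightarrow> real^3) \<Rightarrow> (real \<Rightarrow> real^3) \<Rightarrow> bool" where
  "ICF_solution I J F X \<longleftrightarrow> spacelike_family I J F \<and> (\<forall>s\<in>I. F 0 s = X s) \<and>
     (\<forall>t\<in>J. \<forall>s\<in>I. curvature I (F t) s \<noteq> 0 \<and>
        mink (vector_derivative (\<lambda>t. F t s) (at t within J)) (assoc_curve I (F t) s)
          = - 1 / curvature I (F t) s)"

definition lorentz_motion :: "real set \<Rightarrow> (real \<Rightarrow> real^3^3) \<Rightarrow> bool" where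
  "lorentz_motion J M \<longleftrightarrow> smooth_on J M \<and> M 0 = mat 1 \<and>
     (\<forall>t\<in>J. M t \<in> lorentz_matrices \<and> (\<lambda>p. M t *v p) ` light_cone_pos = light_cone_pos)"

definition CF_soliton :: "real set \<Rightarrow> (real \<Rightarrow> real^3) \<Rightarrow> bool" where
  "CF_soliton I X \<longleftrightarrow>
     (\<exists>J M. lorentz_motion J M \<and> CF_solution I J (\<lambda>t s. M t *v X s) X)"

definition ICF_soliton :: "real set \<Rightarrow> (real \<Rightarrow> real^3) \<Rightarrow> bool" where
  "ICF_soliton I X \<longleftrightarrow>
     (\<exists>J M. lorentz_motion J M \<and> ICF_solution I J (\<lambda>t s. M t *v X s) X)"


section \<open>The associated system\<close>

definition solves_system ::
    "real \<Rightarrow> real set \<Rightarrow> (real \<Rightarrow> real) \<Rightarrow> (real \<Rightarrow> real) \<Rightarrow> (real \<Rightarrow> real) \<Rightarrow> bool" where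
  "solves_system a I \<alpha> \<tau> \<eta> \<longleftrightarrow> (\<forall>s\<in>I.
     (\<alpha> has_real_derivative \<tau> s) (at s within I) \<and>
     (\<tau> has_real_derivative (\<alpha> s / (a * \<tau> s) - \<eta> s)) (at s within I) \<and>
     (\<eta> has_real_derivative (- 1 / a)) (at s within I))"

definition corresponds ::
    "real \<Rightarrow> real set \<Rightarrow> (real \<Rightarrow> real^3) \<Rightarrow> (real \<Rightarrow> real) \<Rightarrow> (real \<Rightarrow> real) \<Rightarrow> (real \<Rightarrow> real) \<Rightarrow> bool"
  where
  "corresponds a I X \<alpha> \<tau> \<eta> \<longleftrightarrow> (let e = vector [1, 1, 0] in \<forall>s\<in>I.
     \<alpha> s = mink (X s) e \<and> \<tau> s = mink (velocity I X s) e \<and> \<eta> s = mink (assoc_al I X s) e \<and>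
     curvature_al I X s \<noteq> 0 \<and> 1 / curvature_al I X s = a * \<tau> s)"

end

theory Submission
  imports Defs
begin

text \<open>Differentiating the Gram relations of \<open>(X, Y, T)\<close> gives \<open>T' = k X - Y\<close> and \<open>Y' = - k T\<close>. Hence \<open>- Y\<close> has
  associated curve \<open>- X\<close> and curvature \<open>1 / k\<close>, and the Lorentz motions that move \<open>X\<close> by the inverse
  curvature flow move \<open>- Y\<close> by the curvature flow.

  Expanding the lightlike vector \<open>e = \<eta> X + \<alpha> Y + \<tau> T\<close> gives \<open>2 \<alpha> \<eta> + \<tau>\<^sup>2 = 0\<close> along the whole curve, so the
  signs of \<open>\<alpha>\<close> and \<open>\<eta>\<close> are constant and \<open>\<tau>' = - \<tau> / (2 a \<eta>) - \<eta>\<close> is linear, with first integral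
  \<open>\<tau> / sqrt \<eta> - (2 a / 3) \<eta>\<^bsup>3/2\<^esup>\<close>. The third components of \<open>e\<close> and of \<open>T = X \<times> Y\<close> yield
  \<open>x\<^sub>3' = - 2 \<eta> x\<^sub>3 / \<tau> - 1\<close>, that is \<open>(x\<^sub>3 / P\<^sup>2)' = - 1 / P\<^sup>2\<close> for \<open>P = \<eta>\<^bsup>3/2\<^esup> + D\<close>.\<close>

section \<open>Calculus on intervals\<close>

text \<open>A connected set with more than one point has no isolated points. This makes derivatives
  within \<open>I\<close> unique, also at an end point that belongs to \<open>I\<close>.\<close>

lemma proper_interval_at_neq_bot:
  assumes "proper_interval I" "s \<in> I"
  shows "at s within I \<noteq> bot"
proof -
  have "connected I" using assms by (simp add: proper_interval_def is_interval_connected_1)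
  moreover have "I \<noteq> {x}" for x using assms by (auto simp: proper_interval_def)
  ultimately show ?thesis
    using connected_imp_perfect[of I s] assms by (simp add: trivial_limit_within)
qed

lemma vector_derivative_proper_interval:
  assumes "proper_interval I" "s \<in> I" "(f has_vector_derivative f') (at s within I)"
  shows "vector_derivative f (at s within I) = f'"
  using vector_derivative_within proper_interval_at_neq_bot assms by blast

text \<open>\<open>I\<close> may be neither open nor closed, so the fundamental theorem of calculus
  is applied on a compact subinterval \<open>{p..q}\<close> that contains \<open>x\<close> and
  \<open>c\<close> and agrees with \<open>I\<close> near \<open>x\<close>. For curves of continuous
  speed this provides a witness for the choice in \<open>arc_length_fun\<close>.\<close>

lemma ex_antiderivative_on:
  fixes f :: "real \<Rightarrow> real"
  assumes I: "is_interval I" and f: "continuous_on I f"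
  shows "\<exists>F. antiderivative_on I f F"
proof (cases "I = {}")
  case False
  then obtain c where c: "c \<in> I" by blast
  \<comment> \<open>The signed integral from \<open>c\<close> to \<open>x\<close>: at least one of
    the two integrals vanishes.\<close>
  define F where "F x = integral {c..x} f - integral {x..c} f" for x
  have "(F has_real_derivative f x) (at x within I)" if x: "x \<in> I" for x
  proof -
    \<comment> \<open>\<open>p\<close> lies strictly left of \<open>x\<close> unless
      \<open>x\<close> is the least element of \<open>I\<close>; \<open>q\<close> below is chosen
      symmetrically.\<close>
    have "\<exists>p\<in>I. p \<le> x \<and> p \<le> c \<and> (p < x \<or> (\<forall>y\<in>I. x \<le> y))"
    proof (cases "\<exists>y\<in>I. y < x")
      case True
      then obtain y where "y \<in> I" "y < x" by blast
      then show ?thesis using c by (intro bexI[of _ "min y c"]) (auto simp: min_def)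
    next
      case False
      then show ?thesis using c x by (intro bexI[of _ x]) (auto simp: not_less)
    qed
    then obtain p where p: "p \<in> I" "p \<le> x" "p \<le> c" "p < x \<or> (\<forall>y\<in>I. x \<le> y)" by blast
    have "\<exists>q\<in>I. x \<le> q \<and> c \<le> q \<and> (x < q \<or> (\<forall>y\<in>I. y \<le> x))"
    proof (cases "\<exists>y\<in>I. x < y")
      case True
      then obtain y where "y \<in> I" "x < y" by blast
      then show ?thesis using c by (intro bexI[of _ "max y c"]) (auto simp: max_def)
    next
      case False
      then show ?thesis using c x by (intro bexI[of _ x]) (auto simp: not_less)
    qed
    then obtain q where q: "q \<in> I" "x \<le> q" "c \<le> q" "x < q \<or> (\<forall>y\<in>I. y \<le> x)" by blast
    have sub: "{p..q} \<subseteq> I"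
      using I p(1) q(1) by (meson atLeastAtMost_iff mem_is_interval_1_I subsetI)
    have cont: "continuous_on {p..q} f" using f sub continuous_on_subset by blast
    have int: "f integrable_on {u..v}" if "p \<le> u" "v \<le> q" for u v
      using cont that by (intro integrable_continuous_real) (auto intro: continuous_on_subset)
    have F_eq: "F y = integral {p..y} f - integral {p..c} f" if y: "y \<in> {p..q}" for y
    proof (cases "c \<le> y")
      case True
      have "integral {p..c} f + integral {c..y} f = integral {p..y} f"
        using True p(3) y by (intro Henstock_Kurzweil_Integration.integral_combine int) auto
      moreover have "integral {y..c} f = 0" using True by (cases "y = c") auto
      ultimately show ?thesis by (simp add: F_def)
    next
      case False
      have "integral {p..y} f + integral {y..c} f = integral {p..c} f"
        using False q(3) y by (intro Henstock_Kurzweil_Integration.integral_combine int) auto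
      moreover have "integral {c..y} f = 0" using False by auto
      ultimately show ?thesis by (simp add: F_def)
    qed
    have "((\<lambda>y. integral {p..y} f - integral {p..c} f) has_real_derivative f x) (at x within {p..q})"
      using integral_has_real_derivative[OF cont, of x] p q by (auto intro!: derivative_eq_intros)
    then have *: "(F has_real_derivative f x) (at x within {p..q})"
      by (rule has_field_derivative_transform_within[where d=1]) (use F_eq p q in auto)
    \<comment> \<open>The window \<open>{u<..<v}\<close> is one in which \<open>I\<close> and
      \<open>{p..q}\<close> coincide. If \<open>p = x\<close>, then \<open>x\<close> is least in
      \<open>I\<close> and any \<open>u\<close> below \<open>x\<close> will do; likewise for
      \<open>v\<close>.\<close>
    define u where "u = (if p < x then p else x - 1)"
    define v where "v = (if x < q then q else x + 1)"
    have "at x within I = at x within {p..q}"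
    proof (rule at_within_nhd[where S = "{u<..<v}"])
      show "I \<inter> {u<..<v} - {x} = {p..q} \<inter> {u<..<v} - {x}"
        using sub p(4) q(4) p(2) q(2) by (force simp: u_def v_def split: if_splits)
    qed (auto simp: u_def v_def)
    with * show ?thesis by simp
  qed
  then show ?thesis by (auto simp: antiderivative_on_def)
qed (auto simp: antiderivative_on_def)

section \<open>Closure properties of smooth maps\<close>

lemma smooth_on_cong:
  assumes "smooth_on I f" "\<And>s. s \<in> I \<Longrightarrow> g s = f s"
  shows "smooth_on I g"
  using assms unfolding smooth_on_def by auto

lemma smooth_onE:
  assumes "smooth_on I f"
  obtains f' where "\<And>s. s \<in> I \<Longrightarrow> (f has_vector_derivative f' s) (at s within I)"
    and "smooth_on I f'"
proof -
  obtain D where D: "\<And>s. s \<in> I \<Longrightarrow> D 0 s = f s"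
    "\<And>n s. s \<in> I \<Longrightarrow> (D n has_vector_derivative D (Suc n) s) (at s within I)"
    using assms unfolding smooth_on_def by blast
  show thesis
  proof
    show "(f has_vector_derivative D 1 s) (at s within I)" if "s \<in> I" for s
      using has_vector_derivative_transform[of s I f "D 0"] D that by simp
    show "smooth_on I (D 1)"
      unfolding smooth_on_def by (rule exI[of _ "\<lambda>n. D (Suc n)"]) (use D in auto)
  qed
qed

lemma has_vector_derivative_continuous_on:
  assumes "\<And>s. s \<in> I \<Longrightarrow> (f has_vector_derivative f' s) (at s within I)"
  shows "continuous_on I f"
  using assms has_vector_derivative_continuous continuous_on_eq_continuous_within by blast

lemma smooth_on_continuous:
  assumes "smooth_on I f"
  shows "continuous_on I f"
  using smooth_onE[OF assms] has_vector_derivative_continuous_on by metis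

lemma smooth_on_diff:
  assumes "smooth_on I f" "smooth_on I g"
  shows "smooth_on I (\<lambda>s. f s - g s)"
proof -
  obtain F G where "\<forall>s\<in>I. F 0 s = f s" "\<forall>s\<in>I. G 0 s = g s"
    "\<forall>n. \<forall>s\<in>I. (F n has_vector_derivative F (Suc n) s) (at s within I)"
    "\<forall>n. \<forall>s\<in>I. (G n has_vector_derivative G (Suc n) s) (at s within I)"
    using assms unfolding smooth_on_def by metis
  then show ?thesis
    unfolding smooth_on_def
    by (intro exI[of _ "\<lambda>n s. F n s - G n s"]) (auto intro!: derivative_eq_intros)
qed

lemma smooth_on_linear:
  assumes "bounded_linear h" "smooth_on I f"
  shows "smooth_on I (\<lambda>s. h (f s))"
proof -
  obtain F where "\<forall>s\<in>I. F 0 s = f s"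
    "\<forall>n. \<forall>s\<in>I. (F n has_vector_derivative F (Suc n) s) (at s within I)"
    using assms(2) unfolding smooth_on_def by metis
  then show ?thesis
    unfolding smooth_on_def
    by (intro exI[of _ "\<lambda>n s. h (F n s)"])
      (auto intro!: bounded_linear.has_vector_derivative[OF assms(1)])
qed

text \<open>The \<open>n\<close>-th derivative of \<open>h (F i) (G j)\<close>, where \<open>F (Suc i)\<close> and \<open>G (Suc j)\<close> are the derivatives
  of \<open>F i\<close> and \<open>G j\<close>; this form of the Leibniz rule avoids binomial coefficients.\<close>

primrec leibniz_deriv ::
    "('b \<Rightarrow> 'c \<Rightarrow> 'a::plus) \<Rightarrow> (nat \<Rightarrow> real \<Rightarrow> 'b) \<Rightarrow> (nat \<Rightarrow> real \<Rightarrow> 'c) \<Rightarrow> nat \<Rightarrow> nat \<Rightarrow> nat \<Rightarrow> real \<Rightarrow> 'a"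
  where
  "leibniz_deriv h F G 0 = (\<lambda>i j s. h (F i s) (G j s))"
| "leibniz_deriv h F G (Suc n) =
     (\<lambda>i j s. leibniz_deriv h F G n i (Suc j) s + leibniz_deriv h F G n (Suc i) j s)"

lemma smooth_on_bilinear:
  assumes h: "bounded_bilinear h" and "smooth_on I f" "smooth_on I g"
  shows "smooth_on I (\<lambda>s. h (f s) (g s))"
proof -
  obtain F G where FG: "\<forall>s\<in>I. F 0 s = f s" "\<forall>s\<in>I. G 0 s = g s"
    "\<forall>n. \<forall>s\<in>I. (F n has_vector_derivative F (Suc n) s) (at s within I)"
    "\<forall>n. \<forall>s\<in>I. (G n has_vector_derivative G (Suc n) s) (at s within I)"
    using assms unfolding smooth_on_def by metis
  have "(leibniz_deriv h F G n i j has_vector_derivative leibniz_deriv h F G (Suc n) i j s)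
      (at s within I)" if s: "s \<in> I" for n i j s
  proof (induction n arbitrary: i j)
    case 0
    show ?case
      using bounded_bilinear.has_vector_derivative[OF h] FG(3,4) s by simp
  next
    case (Suc n)
    show ?case
      using has_vector_derivative_add[OF Suc[of i "Suc j"] Suc[of "Suc i" j]] by simp
  qed
  then show ?thesis
    unfolding smooth_on_def
    by (intro exI[of _ "\<lambda>n. leibniz_deriv h F G n 0 0"]) (use FG(1,2) in auto)
qed

section \<open>Frenet equations on the light cone\<close>

lemma bounded_bilinear_mink: "bounded_bilinear mink"
  unfolding bilinear_conv_bounded_bilinear[symmetric] bilinear_def linear_iff
  by (auto simp: mink_def algebra_simps)

lemma bounded_bilinear_matrix_vector_mult:
  "bounded_bilinear ((*v) :: real^'n^'m \<Rightarrow> real^'n \<Rightarrow> real^'m)"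
  unfolding bilinear_conv_bounded_bilinear[symmetric] bilinear_def linear_iff
  by (auto simp: matrix_vector_mult_add_rdistrib matrix_vector_right_distrib
      scaleR_matrix_vector_assoc matrix_vector_mult_scaleR)

interpretation mink: bounded_bilinear mink
  by (rule bounded_bilinear_mink)

lemma mink_commute: "mink u v = mink v u"
  by (simp add: mink_def)

text \<open>The product rule, together with uniqueness of derivatives within \<open>I\<close>.
  Applied to one constant product after another, it yields the Frenet relations.\<close>

lemma mink_zero_deriv:
  assumes "proper_interval I" "s \<in> I" "\<And>s. s \<in> I \<Longrightarrow> mink (f s) (g s) = c"
    and "(f has_vector_derivative f') (at s within I)" "(g has_vector_derivative g') (at s within I)"
  shows "mink (f s) g' + mink f' (g s) = 0"
proof -
  have "((\<lambda>s. mink (f s) (g s)) has_vector_derivative mink (f s) g' + mink f' (g s)) (at s within I)"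
    by (rule mink.has_vector_derivative[OF assms(4,5)])
  moreover have "((\<lambda>s. mink (f s) (g s)) has_vector_derivative 0) (at s within I)"
    using has_vector_derivative_transform[OF assms(2), of "\<lambda>s. mink (f s) (g s)" "\<lambda>_. c" 0] assms(3)
    by simp
  ultimately show ?thesis
    using vector_derivative_unique_within proper_interval_at_neq_bot assms(1,2) by blast
qed

section \<open>Linear algebra of pseudo-orthonormal frames\<close>

lemma vec3_eq_iff: "(x :: 'a^3) = y \<longleftrightarrow> x $ 1 = y $ 1 \<and> x $ 2 = y $ 2 \<and> x $ 3 = y $ 3"
  by (simp add: vec_eq_iff forall_3)

text \<open>The expression is the determinant of the matrix with rows \<open>x\<close>,
  \<open>y\<close>, \<open>t\<close>. Since the Minkowski form has determinant -1, its square is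
  minus the Gram determinant, and the assumed products make the Gram determinant -1.\<close>

lemma pseudo_orthonormal_det:
  assumes "mink x x = 0" "mink y y = 0" "mink t t = 1" "mink x y = 1" "mink t x = 0" "mink t y = 0"
  shows "(x $ 1 * (y $ 2 * t $ 3 - y $ 3 * t $ 2) - x $ 2 * (y $ 1 * t $ 3 - y $ 3 * t $ 1)
    + x $ 3 * (y $ 1 * t $ 2 - y $ 2 * t $ 1))\<^sup>2 = 1" (is "?d\<^sup>2 = 1")
proof -
  have "?d\<^sup>2 = - (mink x x * (mink y y * mink t t - (mink t y)\<^sup>2)
      - mink x y * (mink x y * mink t t - mink t y * mink t x)
      + mink t x * (mink x y * mink t y - mink y y * mink t x))"
    by (simp add: mink_def algebra_simps power2_eq_square)
  then show ?thesis using assms by simp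
qed

text \<open>The difference \<open>w\<close> of the two sides is orthogonal to all three frame
  vectors, and these are linearly independent, so \<open>w = 0\<close>.\<close>

lemma pseudo_orthonormal_expansion:
  assumes "mink x x = 0" "mink y y = 0" "mink t t = 1" "mink x y = 1" "mink t x = 0" "mink t y = 0"
  shows "v = mink v y *\<^sub>R x + mink v x *\<^sub>R y + mink v t *\<^sub>R t"
proof -
  define w where "w = v - (mink v y *\<^sub>R x + mink v x *\<^sub>R y + mink v t *\<^sub>R t)"
  define d where "d = x $ 1 * (y $ 2 * t $ 3 - y $ 3 * t $ 2) - x $ 2 * (y $ 1 * t $ 3 - y $ 3 * t $ 1)
    + x $ 3 * (y $ 1 * t $ 2 - y $ 2 * t $ 1)"
  have d: "d \<noteq> 0" using pseudo_orthonormal_det[OF assms] unfolding d_def[symmetric] by auto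
  have "mink w x = 0" "mink w y = 0" "mink w t = 0"
    using assms mink_commute[of y x] mink_commute[of x t] mink_commute[of y t]
    by (auto simp: w_def mink.diff_left mink.add_left mink.scaleR_left)
  \<comment> \<open>Cramer's rule for the linear system with right-hand sides
    \<open>mink w x\<close>, \<open>mink w y\<close>, \<open>mink w t\<close>; its determinant is
    \<open>- d\<close>, because the first coordinate enters \<open>mink\<close> with a minus
    sign.\<close>
  moreover have "d * w $ 1 = - (mink w x * (y $ 2 * t $ 3 - y $ 3 * t $ 2)
     - mink w y * (x $ 2 * t $ 3 - x $ 3 * t $ 2) + mink w t * (x $ 2 * y $ 3 - x $ 3 * y $ 2))"
    by (simp add: d_def mink_def algebra_simps)
  moreover have "d * w $ 2 = - (mink w x * (y $ 1 * t $ 3 - y $ 3 * t $ 1)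
     - mink w y * (x $ 1 * t $ 3 - x $ 3 * t $ 1) + mink w t * (x $ 1 * y $ 3 - x $ 3 * y $ 1))"
    by (simp add: d_def mink_def algebra_simps)
  moreover have "d * w $ 3 = mink w x * (y $ 1 * t $ 2 - y $ 2 * t $ 1)
     - mink w y * (x $ 1 * t $ 2 - x $ 2 * t $ 1) + mink w t * (x $ 1 * y $ 2 - x $ 2 * y $ 1)"
    by (simp add: d_def mink_def algebra_simps)
  ultimately have "w = 0" using d by (simp add: vec3_eq_iff)
  then show ?thesis by (simp add: w_def)
qed

text \<open>Uniqueness behind the definite description: expanding a second candidate
  \<open>y\<close> in the frame of \<open>X s\<close>, \<open>W\<close> and the velocity leaves
  \<open>y = mink y W *\<^sub>R X s + W\<close>, and \<open>mink y y = 0\<close> then forces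
  \<open>mink y W = 0\<close>.\<close>

lemma assoc_al_eqI:
  assumes "X s \<in> light_cone" "mink (velocity I X s) (velocity I X s) = 1"
    "mink (velocity I X s) (X s) = 0"
    and W: "W \<in> light_cone" "mink (velocity I X s) W = 0" "mink (X s) W = 1"
  shows "assoc_al I X s = W"
  unfolding assoc_al_def
proof (rule the_equality)
  fix y assume y: "y \<in> light_cone \<and> mink (velocity I X s) y = 0 \<and> mink (X s) y = 1"
  have eq: "y = mink y W *\<^sub>R X s + mink y (X s) *\<^sub>R W + mink y (velocity I X s) *\<^sub>R velocity I X s"
    by (rule pseudo_orthonormal_expansion) (use assms in \<open>auto simp: light_cone_def\<close>)
  then have eq: "y = mink y W *\<^sub>R X s + W"
    using y by (simp add: mink_commute)
  have "0 = mink y y" using y by (simp add: light_cone_def)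
  also have "\<dots> = mink y W * mink y (X s) + mink y W"
    by (subst (2) eq) (simp add: mink.add_right mink.scaleR_right)
  finally show "y = W" using y eq by (simp add: mink_commute)
qed (use W in simp)

lemma curvature_al_eqI:
  assumes "X s \<noteq> 0" "vector_derivative (velocity I X) (at s within I) = k *\<^sub>R X s - assoc_al I X s"
  shows "curvature_al I X s = k"
  unfolding curvature_al_def by (rule the_equality) (use assms in auto)

lemma has_real_derivative_inv_into:
  fixes \<phi> :: "real \<Rightarrow> real"
  assumes I: "is_interval I" and s: "s \<in> I"
    and \<phi>: "\<And>s. s \<in> I \<Longrightarrow> (\<phi> has_real_derivative v s) (at s within I)"
    and inj: "inj_on \<phi> I" and v: "v s \<noteq> 0"
  shows "(inv_into I \<phi> has_real_derivative inverse (v s)) (at (\<phi> s) within \<phi> ` I)"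
proof -
  have cont: "continuous_on I \<phi>"
    using \<phi> by (meson DERIV_continuous continuous_on_eq_continuous_within)
  obtain g where g: "homeomorphism I (\<phi> ` I) \<phi> g"
    using injective_into_1d_eq_homeomorphism[OF cont] inj I
    by (auto simp: is_interval_path_connected_1)
  have "continuous_on (\<phi> ` I) (inv_into I \<phi>)"
    using g inj by (subst continuous_on_cong[OF refl, of _ _ g])
      (auto simp: homeomorphism_def)
  then have "(inv_into I \<phi> \<longlongrightarrow> s) (at (\<phi> s) within \<phi> ` I)"
    using s inj by (metis continuous_on imageI inv_into_f_f)
  \<comment> \<open>Convergence in the punctured filter also requires that the inverse avoids the
    value \<open>s\<close> itself.\<close>
  moreover have "\<forall>\<^sub>F y in at (\<phi> s) within \<phi> ` I. inv_into I \<phi> y \<in> I - {s}"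
    unfolding eventually_at_filter
    by (rule always_eventually) (metis DiffI f_inv_into_f imageE inv_into_into singletonD)
  ultimately have lim: "filterlim (inv_into I \<phi>) (at s within I) (at (\<phi> s) within \<phi> ` I)"
    by (auto simp: filterlim_at elim: eventually_mono)
  have "((\<lambda>y. inverse ((\<phi> y - \<phi> s) / (y - s))) \<longlongrightarrow> inverse (v s)) (at s within I)"
    using \<phi>[OF s] v by (intro tendsto_inverse) (auto simp: has_field_derivative_iff)
  then have "((\<lambda>y. inverse ((\<phi> (inv_into I \<phi> y) - \<phi> s) / (inv_into I \<phi> y - s))) \<longlongrightarrow> inverse (v s))
      (at (\<phi> s) within \<phi> ` I)"
    using lim by (rule filterlim_compose)
  then have "((\<lambda>y. (inv_into I \<phi> y - inv_into I \<phi> (\<phi> s)) / (y - \<phi> s)) \<longlongrightarrow> inverse (v s))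
      (at (\<phi> s) within \<phi> ` I)"
    by (rule Lim_transform_eventually) (use s inj in \<open>auto simp: eventually_at_filter f_inv_into_f\<close>)
  then show ?thesis by (simp add: has_field_derivative_iff)
qed

lemma proper_interval_image:
  fixes \<phi> :: "real \<Rightarrow> real"
  assumes I: "proper_interval I" and cont: "continuous_on I \<phi>" and inj: "inj_on \<phi> I"
  shows "proper_interval (\<phi> ` I)"
proof -
  have "connected (\<phi> ` I)"
    using I cont connected_continuous_image by (auto simp: proper_interval_def is_interval_connected_1)
  moreover obtain x where x: "x \<in> interior I" using I by (auto simp: proper_interval_def)
  then obtain e where e: "e > 0" "cball x e \<subseteq> I" by (auto simp: mem_interior_cball)
  then have "x \<in> I" "x + e \<in> I" by (auto simp: subset_iff dist_real_def)
  then have "\<phi> x \<noteq> \<phi> (x + e)" using e(1) inj by (metis inj_onD less_add_same_cancel1 less_irrefl)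
  with \<open>x \<in> I\<close> \<open>x + e \<in> I\<close> obtain p q where pq: "p \<in> \<phi> ` I" "q \<in> \<phi> ` I" "p < q"
    by (meson imageI linorder_neqE_linordered_idom)
  ultimately have "{p..q} \<subseteq> \<phi> ` I" by (intro connected_contains_Icc)
  then have "interior {p..q} \<subseteq> interior (\<phi> ` I)" by (rule interior_mono)
  then have "interior (\<phi> ` I) \<noteq> {}" using pq(3) dense by auto
  with \<open>connected (\<phi> ` I)\<close> show ?thesis by (simp add: proper_interval_def is_interval_connected_1)
qed

text \<open>Reads the associated curve and the curvature off any frame that satisfies the Frenet
  equations up to a common speed factor \<open>v\<close>. Passing to arc length divides every
  derivative by \<open>v\<close>, so the arc-length function never has to be computed.\<close>

lemma frenet_reparam:
  assumes I: "proper_interval I"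
    and Z: "\<And>s. s \<in> I \<Longrightarrow> (Z has_vector_derivative v s *\<^sub>R T s) (at s within I)"
    and T: "\<And>s. s \<in> I \<Longrightarrow> (T has_vector_derivative v s *\<^sub>R (\<kappa> s *\<^sub>R Z s - W s)) (at s within I)"
    and v: "\<And>s. s \<in> I \<Longrightarrow> v s > 0" "continuous_on I v"
    and cone: "\<And>s. s \<in> I \<Longrightarrow> Z s \<in> light_cone" "\<And>s. s \<in> I \<Longrightarrow> W s \<in> light_cone"
    and gram: "\<And>s. s \<in> I \<Longrightarrow> mink (T s) (T s) = 1" "\<And>s. s \<in> I \<Longrightarrow> mink (T s) (Z s) = 0"
      "\<And>s. s \<in> I \<Longrightarrow> mink (T s) (W s) = 0" "\<And>s. s \<in> I \<Longrightarrow> mink (Z s) (W s) = 1"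
    and s: "s \<in> I"
  shows "assoc_curve I Z s = W s \<and> curvature I Z s = \<kappa> s"
proof -
  define \<phi> where "\<phi> = arc_length_fun I Z"
  define \<psi> where "\<psi> = inv_into I \<phi>"
  have "velocity I Z s = v s *\<^sub>R T s" if "s \<in> I" for s
    using vector_derivative_proper_interval[OF I that Z[OF that]] by (simp add: velocity_def)
  then have speed: "sqrt (mink (velocity I Z s) (velocity I Z s)) = v s" if "s \<in> I" for s
    using v(1)[OF that] that gram(1) by (simp add: mink.scaleR_left mink.scaleR_right)
  have "\<exists>\<phi>. antiderivative_on I (\<lambda>s. sqrt (mink (velocity I Z s) (velocity I Z s))) \<phi>"
    using ex_antiderivative_on[of I v] I v(2) speed
    by (auto simp: proper_interval_def antiderivative_on_def)
  then have "antiderivative_on I (\<lambda>s. sqrt (mink (velocity I Z s) (velocity I Z s))) \<phi>"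
    unfolding \<phi>_def arc_length_fun_def by (rule someI_ex)
  then have \<phi>: "(\<phi> has_real_derivative v s) (at s within I)" if "s \<in> I" for s
    using that speed by (auto simp: antiderivative_on_def)
  have int: "is_interval I" using I by (simp add: proper_interval_def)
  \<comment> \<open>Positive speed makes the arc-length function strictly increasing, hence
    invertible; the mean value argument uses only interior points of \<open>{x..y}\<close>.\<close>
  have less: "\<phi> x < \<phi> y" if "x \<in> I" "y \<in> I" "x < y" for x y
  proof -
    have sub: "{x..y} \<subseteq> I"
      using int that by (meson atLeastAtMost_iff mem_is_interval_1_I subsetI)
    have *: "(\<phi> has_real_derivative v z) (at z within {x..y})" if "z \<in> {x..y}" for z
      using \<phi> sub that by (meson DERIV_subset in_mono)
    show ?thesis
    proof (rule DERIV_pos_imp_increasing_open[OF that(3)])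
      show "continuous_on {x..y} \<phi>"
        using * by (meson DERIV_continuous continuous_on_eq_continuous_within)
      show "\<exists>D. DERIV \<phi> z :> D \<and> D > 0" if "x < z" "z < y" for z
      proof -
        have "(\<phi> has_real_derivative v z) (at z within {x..y})" using * that by simp
        then have "DERIV \<phi> z :> v z" using that by (simp add: at_within_Icc_at)
        moreover have "v z > 0" using v(1) sub that by (simp add: subset_eq)
        ultimately show ?thesis by blast
      qed
    qed
  qed
  then have inj: "inj_on \<phi> I"
    by (metis inj_onI linorder_neqE_linordered_idom order_less_irrefl)
  have \<psi>\<phi>: "\<psi> (\<phi> s) = s" if "s \<in> I" for s using inj that by (simp add: \<psi>_def)
  have K: "proper_interval (\<phi> ` I)"
    using \<phi> by (intro proper_interval_image I inj)
      (meson DERIV_continuous continuous_on_eq_continuous_within)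
  have \<psi>: "(\<psi> has_vector_derivative inverse (v s)) (at (\<phi> s) within \<phi> ` I)" if "s \<in> I" for s
    using has_real_derivative_inv_into[OF int that \<phi> inj] v(1)[OF that]
    by (simp add: \<psi>_def has_real_derivative_iff_has_vector_derivative)
  have im: "\<psi> ` \<phi> ` I = I" using \<psi>\<phi> by force
  \<comment> \<open>The chain rule with \<open>inverse (v s)\<close> as the derivative of
    \<open>\<psi>\<close>; this factor cancels the speed in the derivatives of \<open>Z\<close> and
    \<open>T\<close>.\<close>
  have comp: "((f \<circ> \<psi>) has_vector_derivative inverse (v s) *\<^sub>R f') (at (\<phi> s) within \<phi> ` I)"
    if "s \<in> I" "(f has_vector_derivative f') (at s within I)" for f :: "real \<Rightarrow> real^3" and f' s
    by (rule vector_diff_chain_within[OF \<psi>[OF that(1)]]) (use that im \<psi>\<phi> in simp)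
  have vel: "velocity (\<phi> ` I) (Z \<circ> \<psi>) (\<phi> s) = T s" if "s \<in> I" for s
    using vector_derivative_proper_interval[OF K _ comp[OF that Z[OF that]]] that v(1)[OF that]
    by (simp add: velocity_def)
  have acc: "vector_derivative (velocity (\<phi> ` I) (Z \<circ> \<psi>)) (at (\<phi> s) within \<phi> ` I)
      = \<kappa> s *\<^sub>R Z s - W s"
  proof (rule vector_derivative_proper_interval[OF K])
    have "((T \<circ> \<psi>) has_vector_derivative \<kappa> s *\<^sub>R Z s - W s) (at (\<phi> s) within \<phi> ` I)"
      using comp[OF s T[OF s]] v(1)[OF s] by simp
    then show "(velocity (\<phi> ` I) (Z \<circ> \<psi>) has_vector_derivative \<kappa> s *\<^sub>R Z s - W s)
        (at (\<phi> s) within \<phi> ` I)"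
      by (rule has_vector_derivative_transform[rotated 2]) (use s vel \<psi>\<phi> in auto)
  qed (use s in simp)
  have *: "assoc_al (\<phi> ` I) (Z \<circ> \<psi>) (\<phi> s) = W s"
    by (rule assoc_al_eqI) (use s vel gram cone \<psi>\<phi> in auto)
  then have "assoc_curve I Z s = W s"
    by (simp add: assoc_curve_def arc_length_repar_def \<phi>_def \<psi>_def)
  moreover have "curvature_al (\<phi> ` I) (Z \<circ> \<psi>) (\<phi> s) = \<kappa> s"
    by (rule curvature_al_eqI) (use s acc * \<psi>\<phi> cone(1)[OF s] in \<open>auto simp: light_cone_def\<close>)
  then have "curvature I Z s = \<kappa> s"
    by (simp add: curvature_def arc_length_repar_def \<phi>_def \<psi>_def)
  ultimately show ?thesis by simp
qed

text \<open>Explicit candidates for the curvature and the associated curve are built from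
  \<open>X\<close> and its second derivative and then identified with the definite descriptions.
  Their smoothness follows because they are polynomial in these data.\<close>

lemma arc_length_curveE:
  assumes X: "arc_length_curve I X"
  obtains "\<And>s. s \<in> I \<Longrightarrow> (X has_vector_derivative velocity I X s) (at s within I)"
    and "\<And>s. s \<in> I \<Longrightarrow> (velocity I X has_vector_derivative
          curvature_al I X s *\<^sub>R X s - assoc_al I X s) (at s within I)"
    and "\<And>s. s \<in> I \<Longrightarrow> (assoc_al I X has_vector_derivative
          - curvature_al I X s *\<^sub>R velocity I X s) (at s within I)"
    and "\<And>s. s \<in> I \<Longrightarrow> mink (X s) (X s) = 0"
    and "\<And>s. s \<in> I \<Longrightarrow> mink (assoc_al I X s) (assoc_al I X s) = 0"
    and "\<And>s. s \<in> I \<Longrightarrow> mink (velocity I X s) (velocity I X s) = 1"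
    and "\<And>s. s \<in> I \<Longrightarrow> mink (X s) (assoc_al I X s) = 1"
    and "\<And>s. s \<in> I \<Longrightarrow> mink (velocity I X s) (X s) = 0"
    and "\<And>s. s \<in> I \<Longrightarrow> mink (velocity I X s) (assoc_al I X s) = 0"
    and "smooth_on I (curvature_al I X)" and "smooth_on I (assoc_al I X)"
proof -
  have I: "proper_interval I" and smX: "smooth_on I X"
    and XX: "\<And>s. s \<in> I \<Longrightarrow> mink (X s) (X s) = 0" and X0: "\<And>s. s \<in> I \<Longrightarrow> X s \<in> light_cone"
    and TT: "\<And>s. s \<in> I \<Longrightarrow> mink (velocity I X s) (velocity I X s) = 1"
    using X unfolding arc_length_curve_def spacelike_curve_def light_cone_def by auto
  obtain X' where X': "\<And>s. s \<in> I \<Longrightarrow> (X has_vector_derivative X' s) (at s within I)" "smooth_on I X'"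
    using smooth_onE[OF smX] by blast
  define T where "T = velocity I X"
  have T_eq: "T s = X' s" if "s \<in> I" for s
    using vector_derivative_proper_interval[OF I that X'(1)[OF that]] by (simp add: T_def velocity_def)
  have dX: "(X has_vector_derivative T s) (at s within I)" if "s \<in> I" for s
    using X' T_eq that by simp
  have "smooth_on I T" using X'(2) T_eq by (rule smooth_on_cong)
  then obtain T' where T': "\<And>s. s \<in> I \<Longrightarrow> (T has_vector_derivative T' s) (at s within I)"
    and smT': "smooth_on I T'"
    by (rule smooth_onE) blast
  \<comment> \<open>\<open>T' = k X - Y\<close> forces \<open>\<langle>T', T'\<rangle> = - 2 k\<close>, which expresses \<open>k\<close> and then \<open>Y\<close> through \<open>X\<close> and \<open>T'\<close> alone.\<close>
  define k where "k s = mink (T' s) ((- 1 / 2) *\<^sub>R T' s)" for s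
  define Y where "Y s = k s *\<^sub>R X s - T' s" for s
  have smk: "smooth_on I k"
    unfolding k_def
    by (intro smooth_on_bilinear[OF bounded_bilinear_mink] smT'
        smooth_on_linear[OF bounded_linear_scaleR_right])
  have smY: "smooth_on I Y"
    unfolding Y_def
    by (intro smooth_on_diff smooth_on_bilinear[OF bounded_bilinear_scaleR] smk smX smT')
  \<comment> \<open>The relations come from differentiating \<open>mink X X = 0\<close>, then
    \<open>mink T X = 0\<close>, and \<open>mink T T = 1\<close>.\<close>
  have TX: "mink (T s) (X s) = 0" if "s \<in> I" for s
    using mink_zero_deriv[OF I that XX dX dX] that by (simp add: mink_commute)
  have T'X: "mink (T' s) (X s) = - 1" if "s \<in> I" for s
    using mink_zero_deriv[OF I that TX T' dX] that TT by (simp add: T_def)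
  have T'T: "mink (T' s) (T s) = 0" if "s \<in> I" for s
    using mink_zero_deriv[OF I that TT[folded T_def] T' T'] that by (simp add: mink_commute)
  have XY: "mink (X s) (Y s) = 1" if "s \<in> I" for s
    using that XX T'X by (simp add: Y_def mink.diff_right mink.scaleR_right mink_commute)
  have YY: "mink (Y s) (Y s) = 0" if "s \<in> I" for s
    using that XX T'X
    by (simp add: Y_def k_def mink.diff_right mink.diff_left mink.scaleR_right mink.scaleR_left
        mink.minus_right mink.minus_left mink_commute[of "X s" "T' s"])
  have TY: "mink (T s) (Y s) = 0" if "s \<in> I" for s
    using that TX T'T by (simp add: Y_def mink.diff_right mink.scaleR_right mink_commute)
  have assoc: "assoc_al I X s = Y s" if "s \<in> I" for s
  proof (rule assoc_al_eqI)
    show "Y s \<in> light_cone" using YY[OF that] XY[OF that] by (auto simp: light_cone_def mink.zero_right)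
  qed (use that X0 TT TX TY XY T_def in auto)
  have curv: "curvature_al I X s = k s" if "s \<in> I" for s
    using X0[OF that] vector_derivative_proper_interval[OF I that T'[OF that]] assoc[OF that]
    by (intro curvature_al_eqI) (auto simp: light_cone_def Y_def T_def)
  have dT: "(T has_vector_derivative k s *\<^sub>R X s - Y s) (at s within I)" if "s \<in> I" for s
    using T'[OF that] by (simp add: Y_def)
  obtain Y' where Y': "\<And>s. s \<in> I \<Longrightarrow> (Y has_vector_derivative Y' s) (at s within I)"
    using smooth_onE[OF smY] by blast
  \<comment> \<open>\<open>Y'\<close> is determined by its products with the frame; these follow
    from differentiating the constant products of \<open>Y\<close> with \<open>Y\<close>,
    \<open>X\<close> and \<open>T\<close>.\<close>
  have dY: "(Y has_vector_derivative - k s *\<^sub>R T s) (at s within I)" if s: "s \<in> I" for s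
  proof -
    have "mink (Y' s) (Y s) = 0"
      using mink_zero_deriv[OF I s YY Y' Y'] s by (simp add: mink_commute)
    moreover have "mink (Y' s) (X s) = 0"
      using mink_zero_deriv[OF I s XY dX Y'] s TY by (simp add: mink_commute)
    moreover have "mink (Y' s) (T s) = - k s"
      using mink_zero_deriv[OF I s TY dT Y'] s XY YY
      by (simp add: mink_commute mink.diff_right mink.scaleR_right)
    moreover have "Y' s = mink (Y' s) (Y s) *\<^sub>R X s + mink (Y' s) (X s) *\<^sub>R Y s + mink (Y' s) (T s) *\<^sub>R T s"
      by (rule pseudo_orthonormal_expansion) (use s XX YY TT XY TX TY T_def in auto)
    ultimately have "Y' s = - k s *\<^sub>R T s" by simp
    then show ?thesis using Y'[OF s] by simp
  qed
  show thesis
  proof (rule that)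
    show "(assoc_al I X has_vector_derivative - curvature_al I X s *\<^sub>R velocity I X s) (at s within I)"
      if "s \<in> I" for s
      using has_vector_derivative_transform[OF that assoc dY[OF that]] curv[OF that]
      by (simp add: T_def)
    show "smooth_on I (assoc_al I X)" "smooth_on I (curvature_al I X)"
      using smY smk assoc curv smooth_on_cong by blast+
  qed (use dX dT XX YY TT XY TX TY assoc curv T_def in auto)
qed

section \<open>Solitons\<close>

lemma light_cone_posD:
  assumes "p \<in> light_cone_pos"
  shows "(p $ 1)\<^sup>2 = (p $ 2)\<^sup>2 + (p $ 3)\<^sup>2" "p $ 1 > 0"
  using assms by (auto simp: light_cone_pos_def light_cone_def mink_def power2_eq_square)

text \<open>Cauchy-Schwarz for the spatial parts bounds the square of
  \<open>x $ 1 * y $ 1 + 1\<close> by that of \<open>x $ 1 * y $ 1\<close>. Hence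
  \<open>x $ 1 * y $ 1\<close> is negative, and so is \<open>y $ 1\<close>.\<close>

lemma neg_assoc_in_light_cone_pos:
  assumes "x \<in> light_cone_pos" "mink y y = 0" "mink x y = 1"
  shows "- y \<in> light_cone_pos"
proof -
  note x = light_cone_posD[OF assms(1)]
  have y: "(y $ 1)\<^sup>2 = (y $ 2)\<^sup>2 + (y $ 3)\<^sup>2"
    and xy: "x $ 2 * y $ 2 + x $ 3 * y $ 3 = x $ 1 * y $ 1 + 1"
    using assms(2,3) by (simp_all add: mink_def power2_eq_square)
  \<comment> \<open>Lagrange's identity for the spatial parts, whose squared lengths are those of
    the first coordinates on the cone.\<close>
  have "(x $ 2 * y $ 2 + x $ 3 * y $ 3)\<^sup>2 + (x $ 2 * y $ 3 - x $ 3 * y $ 2)\<^sup>2 = (x $ 1)\<^sup>2 * (y $ 1)\<^sup>2"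
    unfolding x y by (simp add: power2_eq_square algebra_simps)
  then have "(x $ 1 * y $ 1 + 1)\<^sup>2 \<le> (x $ 1 * y $ 1)\<^sup>2"
    by (metis xy le_add_same_cancel1 power_mult_distrib zero_le_power2)
  then have "2 * (x $ 1 * y $ 1) + 1 \<le> 0"
    by (simp add: power2_eq_square algebra_simps)
  moreover have "x $ 1 * y $ 1 \<ge> 0" if "y $ 1 \<ge> 0" using x(2) that by simp
  ultimately have "y $ 1 < 0" by linarith
  then show ?thesis
    using assms(2) by (auto simp: light_cone_pos_def light_cone_def mink_def vec3_eq_iff)
qed

text \<open>The variables separate: the mixed partial derivative is the \<open>n\<close>-th
  derivative of \<open>M\<close> at \<open>t\<close> applied to the \<open>m\<close>-th derivative
  of \<open>Z\<close> at \<open>s\<close>.\<close>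

lemma smooth_family_matrix_vector_mult:
  assumes "smooth_on J M" "smooth_on I Z"
  shows "smooth_family I J (\<lambda>t s. M t *v Z s)"
proof -
  obtain N W where N: "\<And>t. t \<in> J \<Longrightarrow> N 0 t = M t"
    "\<And>n t. t \<in> J \<Longrightarrow> (N n has_vector_derivative N (Suc n) t) (at t within J)"
    and W: "\<And>s. s \<in> I \<Longrightarrow> W 0 s = Z s"
    "\<And>n s. s \<in> I \<Longrightarrow> (W n has_vector_derivative W (Suc n) s) (at s within I)"
    using assms unfolding smooth_on_def by metis
  have cN: "continuous_on J (N n)" for n
    by (rule has_vector_derivative_continuous_on[OF N(2)])
  have cW: "continuous_on I (W n)" for n
    by (rule has_vector_derivative_continuous_on[OF W(2)])
  have "continuous_on (I \<times> J) (\<lambda>x. N n (snd x) *v W m (fst x))" for m n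
  proof (rule bounded_bilinear.continuous_on[OF bounded_bilinear_matrix_vector_mult])
    show "continuous_on (I \<times> J) (\<lambda>x. N n (snd x))"
      by (rule continuous_on_compose2[OF cN continuous_on_snd[OF continuous_on_id]]) auto
    show "continuous_on (I \<times> J) (\<lambda>x. W m (fst x))"
      by (rule continuous_on_compose2[OF cW continuous_on_fst[OF continuous_on_id]]) auto
  qed
  moreover have "((\<lambda>s. N n t *v W m s) has_vector_derivative N n t *v W (Suc m) s) (at s within I)"
    if "s \<in> I" for m n s t
    by (rule bounded_linear.has_vector_derivative[OF
          bounded_bilinear.bounded_linear_right[OF bounded_bilinear_matrix_vector_mult] W(2)[OF that]])
  moreover have "((\<lambda>t. N n t *v W m s) has_vector_derivative N (Suc n) t *v W m s) (at t within J)"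
    if "t \<in> J" for m n s t
    by (rule bounded_linear.has_vector_derivative[OF
          bounded_bilinear.bounded_linear_left[OF bounded_bilinear_matrix_vector_mult] N(2)[OF that]])
  ultimately show ?thesis
    unfolding smooth_family_def
    by (intro exI[of _ "\<lambda>m n t s. N n t *v W m s"]) (auto simp: N W case_prod_beta)
qed

text \<open>By the intermediate value theorem one constant sign serves the whole interval. A
  constant \<open>\<epsilon>\<close> lets a unit tangent of the form
  \<open>\<epsilon> *\<^sub>R T s\<close> be differentiated directly.\<close>

lemma continuous_on_nonzero_sign:
  fixes f :: "real \<Rightarrow> real"
  assumes "is_interval I" "continuous_on I f" "\<And>s. s \<in> I \<Longrightarrow> f s \<noteq> 0"
  obtains \<epsilon> where "\<epsilon>\<^sup>2 = 1" "\<And>s. s \<in> I \<Longrightarrow> f s = \<epsilon> * \<bar>f s\<bar>"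
proof (cases "\<exists>p\<in>I. f p < 0")
  case True
  then obtain p where p: "p \<in> I" "f p < 0" by blast
  have "connected (f ` I)"
    using assms(1,2) connected_continuous_image by (auto simp: is_interval_connected_1)
  have "f s < 0" if "s \<in> I" for s
  proof (rule ccontr)
    assume "\<not> f s < 0"
    then have "0 \<in> {f p..f s}" using p by auto
    then have "0 \<in> f ` I"
      using connected_contains_Icc[OF \<open>connected (f ` I)\<close>, of "f p" "f s"] p that by blast
    then show False using assms(3) by auto
  qed
  then show thesis using that[of "- 1"] by force
next
  case False
  then show thesis using that[of 1] by (auto simp: not_less)
qed

lemma lorentz_matricesD: "A \<in> lorentz_matrices \<Longrightarrow> mink (A *v u) (A *v v) = mink u v"
  by (simp add: lorentz_matrices_def)

text \<open>A Lorentz motion carrying \<open>X\<close> along the inverse curvature flow carries \<open>- Y\<close> along the curvature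
  flow: \<open>- Y\<close> has associated curve \<open>- X\<close> and curvature \<open>1 / k\<close>, and \<open>\<langle>M' X, M Y\<rangle> = - \<langle>M X, M' Y\<rangle>\<close>.\<close>

theorem CF_soliton_neg_assoc:
  assumes X: "arc_length_curve I X" and pos: "\<forall>s\<in>I. X s \<in> light_cone_pos"
    and sol: "ICF_soliton I X"
  shows "CF_soliton I (\<lambda>s. - assoc_al I X s)"
proof -
  define T Y k where "T = velocity I X" and "Y = assoc_al I X" and "k = curvature_al I X"
  note frenet = arc_length_curveE[OF X, folded T_def Y_def k_def]
  have I: "proper_interval I" using X by (simp add: arc_length_curve_def spacelike_curve_def)
  have dX: "\<And>s. s \<in> I \<Longrightarrow> (X has_vector_derivative T s) (at s within I)"
    and dT: "\<And>s. s \<in> I \<Longrightarrow> (T has_vector_derivative k s *\<^sub>R X s - Y s) (at s within I)"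
    and dY: "\<And>s. s \<in> I \<Longrightarrow> (Y has_vector_derivative - k s *\<^sub>R T s) (at s within I)"
    and gram: "\<And>s. s \<in> I \<Longrightarrow> mink (X s) (X s) = 0" "\<And>s. s \<in> I \<Longrightarrow> mink (Y s) (Y s) = 0"
      "\<And>s. s \<in> I \<Longrightarrow> mink (T s) (T s) = 1" "\<And>s. s \<in> I \<Longrightarrow> mink (X s) (Y s) = 1"
      "\<And>s. s \<in> I \<Longrightarrow> mink (T s) (X s) = 0" "\<And>s. s \<in> I \<Longrightarrow> mink (T s) (Y s) = 0"
    and smk: "smooth_on I k" and smY: "smooth_on I Y"
    by (rule frenet; blast)+
  obtain J M where M: "lorentz_motion J M" and ICF: "ICF_solution I J (\<lambda>t s. M t *v X s) X"
    using sol by (auto simp: ICF_soliton_def)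
  have J: "proper_interval J" "0 \<in> J"
    using ICF by (auto simp: ICF_solution_def spacelike_family_def)
  have smM: "smooth_on J M" and M0: "M 0 = mat 1"
    and lor: "\<And>t. t \<in> J \<Longrightarrow> M t \<in> lorentz_matrices"
    and im: "\<And>t. t \<in> J \<Longrightarrow> (\<lambda>p. M t *v p) ` light_cone_pos = light_cone_pos"
    using M by (auto simp: lorentz_motion_def)
  obtain M' where M': "\<And>t. t \<in> J \<Longrightarrow> (M has_vector_derivative M' t) (at t within J)"
    using smooth_onE[OF smM] by blast
  note mv = bounded_bilinear_matrix_vector_mult
  note mvR = bounded_linear.has_vector_derivative[OF bounded_bilinear.bounded_linear_right[OF mv]]
  note mvL = bounded_linear.has_vector_derivative[OF bounded_bilinear.bounded_linear_left[OF mv]]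
  have cone: "p \<in> light_cone" if "mink p p = 0" "mink p q = 1 \<or> mink q p = 1" for p q
    using that by (auto simp: light_cone_def mink.zero_left mink.zero_right)
  have lm: "mink (M t *v u) (M t *v v) = mink u v" if "t \<in> J" for t u v
    using lor[OF that] by (rule lorentz_matricesD)
  have X_data: "assoc_curve I (\<lambda>s. M t *v X s) s = M t *v Y s"
    "curvature I (\<lambda>s. M t *v X s) s = k s" if t: "t \<in> J" and s: "s \<in> I" for t s
  proof -
    \<comment> \<open>For fixed \<open>t\<close> the linear isometry \<open>M t\<close> carries the
      frame to one with the same Gram relations and the same Frenet equations, at speed 1.\<close>
    have *: "assoc_curve I (\<lambda>s. M t *v X s) s = M t *v Y s \<and> curvature I (\<lambda>s. M t *v X s) s = k s"
    proof (rule frenet_reparam[OF I, where v = "\<lambda>_. 1" and T = "\<lambda>s. M t *v T s"])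
      fix s assume s: "s \<in> I"
      show "((\<lambda>s. M t *v X s) has_vector_derivative 1 *\<^sub>R (M t *v T s)) (at s within I)"
        using mvR[OF dX[OF s]] by simp
      show "((\<lambda>s. M t *v T s) has_vector_derivative
          1 *\<^sub>R (k s *\<^sub>R (M t *v X s) - M t *v Y s)) (at s within I)"
        using mvR[OF dT[OF s], of "M t"]
        by (simp add: matrix_vector_mult_diff_distrib matrix_vector_mult_scaleR)
      show "M t *v X s \<in> light_cone" "M t *v Y s \<in> light_cone"
        using gram s lm[OF t] by (auto intro: cone[of _ "M t *v Y s"] cone[of _ "M t *v X s"])
    qed (use gram s lm[OF t] in auto)
    show "assoc_curve I (\<lambda>s. M t *v X s) s = M t *v Y s" "curvature I (\<lambda>s. M t *v X s) s = k s"
      using * by auto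
  qed
  have dM: "vector_derivative (\<lambda>t. M t *v p) (at t within J) = M' t *v p" if "t \<in> J" for t p
    by (rule vector_derivative_proper_interval[OF J(1) that mvL[OF M'[OF that]]])
  have k0: "k s \<noteq> 0" and flow: "mink (M' t *v X s) (M t *v Y s) = - 1 / k s"
    if "t \<in> J" "s \<in> I" for t s
  proof -
    have "curvature I (\<lambda>s. M t *v X s) s \<noteq> 0 \<and>
        mink (vector_derivative (\<lambda>t. M t *v X s) (at t within J)) (assoc_curve I (\<lambda>s. M t *v X s) s)
          = - 1 / curvature I (\<lambda>s. M t *v X s) s"
      using ICF that by (simp add: ICF_solution_def)
    then show "k s \<noteq> 0" "mink (M' t *v X s) (M t *v Y s) = - 1 / k s"
      by (simp_all add: X_data[OF that] dM[OF that(1)])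
  qed
  \<comment> \<open>The velocity of \<open>- Y\<close> is \<open>k *\<^sub>R T\<close>. As
    \<open>k\<close> may have either sign, the speed is \<open>\<bar>k s\<bar>\<close> and the unit
    tangent is \<open>\<epsilon> *\<^sub>R T s\<close>.\<close>
  obtain \<epsilon> where \<epsilon>: "\<epsilon>\<^sup>2 = 1" "\<And>s. s \<in> I \<Longrightarrow> k s = \<epsilon> * \<bar>k s\<bar>"
    using continuous_on_nonzero_sign[of I k] I smooth_on_continuous[OF smk] k0[OF J(2)]
    by (auto simp: proper_interval_def)
  have dZ: "((\<lambda>s. M t *v - Y s) has_vector_derivative k s *\<^sub>R (M t *v T s)) (at s within I)"
    if s: "s \<in> I" for s t
    using mvR[OF has_vector_derivative_minus[OF dY[OF s]], of "M t"]
    by (simp add: matrix_vector_mult_scaleR)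
  have Z_data: "assoc_curve I (\<lambda>s. M t *v - Y s) s = M t *v - X s"
    "curvature I (\<lambda>s. M t *v - Y s) s = 1 / k s" if t: "t \<in> J" and s: "s \<in> I" for t s
  proof -
    have *: "assoc_curve I (\<lambda>s. M t *v - Y s) s = M t *v - X s
        \<and> curvature I (\<lambda>s. M t *v - Y s) s = 1 / k s"
    proof (rule frenet_reparam[OF I, where v = "\<lambda>s. \<bar>k s\<bar>" and T = "\<lambda>s. \<epsilon> *\<^sub>R (M t *v T s)"])
      fix s assume s: "s \<in> I"
      note ks = \<epsilon>(2)[OF s] k0[OF J(2) s]
      have ek: "\<bar>k s\<bar> = \<epsilon> * k s" using ks(1) \<epsilon>(1)
        by (metis mult.assoc mult.left_neutral power2_eq_square)
      show "((\<lambda>s. M t *v - Y s) has_vector_derivative \<bar>k s\<bar> *\<^sub>R (\<epsilon> *\<^sub>R (M t *v T s))) (at s within I)"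
        using dZ[OF s, of t] ks(1) by (simp add: mult.commute)
      \<comment> \<open>Up to \<open>M t\<close>, both sides are
        \<open>\<epsilon> *\<^sub>R (k s *\<^sub>R X s - Y s)\<close>: taking the factor
        \<open>\<bar>k s\<bar> = \<epsilon> * k s\<close> out of it exhibits \<open>1 / k s\<close>
        as the curvature and \<open>- X\<close> as the associated curve.\<close>
      show "((\<lambda>s. \<epsilon> *\<^sub>R (M t *v T s)) has_vector_derivative
          \<bar>k s\<bar> *\<^sub>R ((1 / k s) *\<^sub>R (M t *v - Y s) - M t *v - X s)) (at s within I)"
        using bounded_linear.has_vector_derivative[OF bounded_linear_scaleR_right[of \<epsilon>]
            mvR[OF dT[OF s], of "M t"]] ks(2)
        by (simp add: ek matrix_vector_mult_diff_distrib matrix_vector_mult_scaleR algebra_simps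
            bounded_bilinear.minus_right[OF mv])
      show "M t *v - Y s \<in> light_cone" "M t *v - X s \<in> light_cone"
        using gram s lm[OF t] by (auto intro: cone[of _ "M t *v - Y s"] cone[of _ "M t *v - X s"]
            simp: mink.minus_left mink.minus_right mink_commute)
    qed (use gram s lm[OF t] k0[OF J(2)] \<epsilon>(1) smooth_on_continuous[OF smk] in \<open>auto simp:
        mink.minus_left mink.minus_right mink.scaleR_left mink.scaleR_right mink_commute power2_eq_square
        intro!: continuous_intros\<close>)
    show "assoc_curve I (\<lambda>s. M t *v - Y s) s = M t *v - X s"
      "curvature I (\<lambda>s. M t *v - Y s) s = 1 / k s"
      using * by auto
  qed

  \<comment> \<open>The moved curves \<open>- Y\<close> as a spacelike family\<close>
  have smZ: "smooth_on I (\<lambda>s. A *v - Y s)" for A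
    by (intro smooth_on_linear[OF bounded_bilinear.bounded_linear_right[OF mv]]
        smooth_on_linear[OF bounded_linear_minus[OF bounded_linear_ident]] smY)
  have posZ: "M t *v - Y s \<in> light_cone_pos" if t: "t \<in> J" and s: "s \<in> I" for t s
    using neg_assoc_in_light_cone_pos[of "X s" "Y s"] pos gram s im[OF t] by blast
  have "spacelike_curve I (\<lambda>s. M t *v - Y s)" if t: "t \<in> J" for t
    unfolding spacelike_curve_def
  proof (intro conjI ballI I smZ)
    fix s assume s: "s \<in> I"
    show "M t *v - Y s \<in> light_cone" using posZ[OF t s] by (simp add: light_cone_pos_def)
    have "velocity I (\<lambda>s. M t *v - Y s) s = k s *\<^sub>R (M t *v T s)"
      unfolding velocity_def by (rule vector_derivative_proper_interval[OF I s dZ[OF s]])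
    moreover have "k s * k s > 0" using k0[OF t s] by (metis not_real_square_gt_zero)
    ultimately show "mink (velocity I (\<lambda>s. M t *v - Y s) s) (velocity I (\<lambda>s. M t *v - Y s) s) > 0"
      using gram(3)[OF s] lm[OF t] by (simp add: mink.scaleR_left mink.scaleR_right)
  qed
  moreover have "smooth_family I J (\<lambda>t s. M t *v - Y s)"
    by (intro smooth_family_matrix_vector_mult smM
        smooth_on_linear[OF bounded_linear_minus[OF bounded_linear_ident]] smY)
  moreover have "mink (M' t *v - Y s) (M t *v - X s) = 1 / k s" if t: "t \<in> J" and s: "s \<in> I" for t s
    using mink_zero_deriv[OF J(1) t lm mvL[OF M'[OF t], of "X s"] mvL[OF M'[OF t], of "Y s"]]
      flow[OF t s]
    by (simp add: mink.minus_left mink.minus_right mink_commute mv[THEN bounded_bilinear.minus_right])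
  ultimately have "CF_solution I J (\<lambda>t s. M t *v - Y s) (\<lambda>s. - Y s)"
    using J posZ Z_data dM M0 by (simp add: CF_solution_def spacelike_family_def)
  then show ?thesis using M by (auto simp: CF_soliton_def Y_def)
qed

section \<open>The associated system\<close>

text \<open>Split the integrand by \<open>2 u / (u\<^sup>3 + d\<^sup>3)\<^sup>2 = (2 / (3 d\<^sup>3)) * ((u\<^sup>2 / (u\<^sup>3 + d\<^sup>3))' + u / (u\<^sup>3 + d\<^sup>3))\<close> and
  expand the last term in partial fractions with the denominators \<open>u + d\<close> and \<open>u\<^sup>2 - d u + d\<^sup>2\<close>.\<close>

lemma has_real_derivative_log_arctan_primitive:
  fixes d u :: real
  assumes "d > 0" "u > 0"
  shows "((\<lambda>u. 1 / (9 * d ^ 4) * ln ((u\<^sup>2 - d * (u - d)) / (u + d)\<^sup>2)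
      + 2 / (3 * sqrt 3 * d ^ 4) * (arctan ((2 * u - d) / (sqrt 3 * d))
        + sqrt 3 * u\<^sup>2 / (1 / d * u ^ 3 + d\<^sup>2)))
    has_real_derivative 2 * u / (u ^ 3 + d ^ 3)\<^sup>2) (at u)"
proof -
  define Q where "Q = u\<^sup>2 - d * (u - d)"
  \<comment> \<open>Completing the square shows that the quadratic factor of
    \<open>u ^ 3 + d ^ 3\<close> has no real zero.\<close>
  have "Q = (u - d / 2)\<^sup>2 + 3 / 4 * d\<^sup>2" by (simp add: Q_def power2_eq_square field_simps)
  then have Q: "Q > 0" using assms by (simp add: add_nonneg_pos)
  have d0: "d \<noteq> 0" using assms by simp
  have S: "u + d > 0" "sqrt 3 > (0::real)" using assms by auto
  have SQ: "u ^ 3 + d ^ 3 = (u + d) * Q"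
    by (simp add: Q_def algebra_simps power2_eq_square power3_eq_cube)
  have P: "u ^ 3 + d ^ 3 > 0" using assms by (simp add: add_pos_pos)
  have ln: "((\<lambda>u. ln ((u\<^sup>2 - d * (u - d)) / (u + d)\<^sup>2)) has_real_derivative
      (2 * u - d) / Q - 2 / (u + d)) (at u)"
    using Q S assms unfolding Q_def
    by (auto intro!: derivative_eq_intros) (simp add: divide_simps, simp add: eval_nat_numeral algebra_simps)
  have "1 + ((2 * u - d) / (sqrt 3 * d))\<^sup>2 = 4 * Q / (3 * d\<^sup>2)"
    using assms by (simp add: Q_def power_divide power_mult_distrib field_simps)
      (simp add: power2_eq_square algebra_simps)
  then have "inverse (1 + ((2 * u - d) / (sqrt 3 * d))\<^sup>2) * (2 / (sqrt 3 * d)) = sqrt 3 * d / (2 * Q)"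
    using Q d0 by (simp add: divide_simps) (simp add: power2_eq_square)
  moreover have "((\<lambda>u. arctan ((2 * u - d) / (sqrt 3 * d))) has_real_derivative
      inverse (1 + ((2 * u - d) / (sqrt 3 * d))\<^sup>2) * (2 / (sqrt 3 * d))) (at u)"
    using d0 by (auto intro!: derivative_eq_intros)
  ultimately have arctan: "((\<lambda>u. arctan ((2 * u - d) / (sqrt 3 * d))) has_real_derivative
      sqrt 3 * d / (2 * Q)) (at u)"
    by simp
  have "1 / d * u ^ 3 + d\<^sup>2 = (u ^ 3 + d ^ 3) / d" for u
    using assms by (simp add: field_simps power2_eq_square power3_eq_cube)
  moreover have "((\<lambda>u. sqrt 3 * d * (u\<^sup>2 / (u ^ 3 + d ^ 3))) has_real_derivative
      sqrt 3 * d * ((2 * u * (u ^ 3 + d ^ 3) - 3 * u ^ 4) / (u ^ 3 + d ^ 3)\<^sup>2)) (at u)"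
    using P by (auto intro!: derivative_eq_intros simp: field_simps power2_eq_square power3_eq_cube
        power4_eq_xxxx)
  ultimately have quot: "((\<lambda>u. sqrt 3 * u\<^sup>2 / (1 / d * u ^ 3 + d\<^sup>2)) has_real_derivative
      sqrt 3 * d * ((2 * u * (u ^ 3 + d ^ 3) - 3 * u ^ 4) / (u ^ 3 + d ^ 3)\<^sup>2)) (at u)"
    by (simp add: mult_ac)
  \<comment> \<open>The logarithm and the arctangent contribute this sum times
    \<open>1 / (9 * d ^ 4)\<close>. The numerators combine because
    \<open>(u + d)\<^sup>2 - Q = 3 * u * d\<close>.\<close>
  have "((2 * u - d) / Q - 2 / (u + d)) + 3 * d / Q = 6 * u * d / (u ^ 3 + d ^ 3)"
  proof -
    have "((2 * u - d) / Q - 2 / (u + d)) + 3 * d / Q = 2 * ((u + d)\<^sup>2 - Q) / ((u + d) * Q)"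
      using Q S by (simp add: divide_simps) (simp add: power2_eq_square algebra_simps)
    also have "(u + d)\<^sup>2 - Q = 3 * u * d" by (simp add: Q_def power2_eq_square algebra_simps)
    finally show ?thesis by (simp add: SQ)
  qed
  moreover have "1 / (3 * d ^ 3) / Q = 1 / (9 * d ^ 4) * (3 * d / Q)"
    using d0 by (simp add: eval_nat_numeral)
  moreover have "1 / (9 * d ^ 4) * (6 * u * d / z) = 2 * u / (3 * d ^ 3 * z)" for z
    using d0 by (simp add: eval_nat_numeral)
  ultimately have "1 / (9 * d ^ 4) * ((2 * u - d) / Q - 2 / (u + d)) + 1 / (3 * d ^ 3) / Q
      = 2 * u / (3 * d ^ 3 * (u ^ 3 + d ^ 3))"
    by (simp only: distrib_left[symmetric])
  \<comment> \<open>Adding the rational contribution leaves the numerator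
    \<open>u * A - u ^ 4 = u * d ^ 3\<close>, so the factor \<open>d ^ 3\<close> cancels.\<close>
  moreover have "2 * u / (3 * d ^ 3 * A) + 2 / (3 * d ^ 3) * ((2 * u * A - 3 * u ^ 4) / A\<^sup>2) = 2 * u / A\<^sup>2"
    if "A = u ^ 3 + d ^ 3" "A > 0" for A
  proof -
    have "2 * u / (3 * d ^ 3 * A) + 2 / (3 * d ^ 3) * ((2 * u * A - 3 * u ^ 4) / A\<^sup>2)
        = 6 * (u * A - u ^ 4) / (3 * d ^ 3 * A\<^sup>2)"
      using assms that(2) by (simp add: field_simps power2_eq_square)
    also have "u * A - u ^ 4 = u * d ^ 3" by (simp add: that(1) algebra_simps eval_nat_numeral)
    finally show ?thesis using assms by simp
  qed
  ultimately have "1 / (9 * d ^ 4) * ((2 * u - d) / Q - 2 / (u + d)) + 1 / (3 * d ^ 3) / Q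
      + 2 / (3 * d ^ 3) * ((2 * u * (u ^ 3 + d ^ 3) - 3 * u ^ 4) / (u ^ 3 + d ^ 3)\<^sup>2)
      = 2 * u / (u ^ 3 + d ^ 3)\<^sup>2"
    using P by simp
  moreover have "2 / (3 * sqrt 3 * d ^ 4) * (sqrt 3 * d / (2 * Q)) = 1 / (3 * d ^ 3) / Q"
    using assms S by (simp add: eval_nat_numeral)
  moreover have "2 / (3 * sqrt 3 * d ^ 4) * (sqrt 3 * d * z) = 2 / (3 * d ^ 3) * z" for z
    using assms S by (simp add: eval_nat_numeral)
  ultimately have eq: "1 / (9 * d ^ 4) * ((2 * u - d) / Q - 2 / (u + d)) + 2 / (3 * sqrt 3 * d ^ 4) *
      (sqrt 3 * d / (2 * Q) + sqrt 3 * d * ((2 * u * (u ^ 3 + d ^ 3) - 3 * u ^ 4) / (u ^ 3 + d ^ 3)\<^sup>2))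
      = 2 * u / (u ^ 3 + d ^ 3)\<^sup>2"
    by (simp only: distrib_left add.assoc)
  show ?thesis
    using DERIV_add[OF DERIV_cmult[OF ln] DERIV_cmult[OF DERIV_add[OF arctan quot]],
        of "1 / (9 * d ^ 4)" "2 / (3 * sqrt 3 * d ^ 4)"]
    unfolding eq .
qed

lemma powr_three_halves: "x > 0 \<Longrightarrow> x powr (3 / 2) = sqrt x ^ 3" for x :: real
  by (simp add: powr_half_sqrt[symmetric] powr_powr flip: powr_realpow)

text \<open>Substitute \<open>u = sqrt (\<eta> s)\<close>, for which
  \<open>u' = - 1 / (2 * a * u)\<close>, and take \<open>d\<close> to be the cube root of
  \<open>D\<close>. The integrand becomes \<open>- a\<close> times
  \<open>2 * u / (u ^ 3 + d ^ 3)\<^sup>2\<close> times \<open>u'\<close>, and the powers of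
  \<open>D\<close> become integer powers of \<open>d\<close>.\<close>

lemma antiderivative_on_sqrt_cube:
  fixes a D :: real
  assumes a: "a > 0" and D: "D > 0"
    and \<eta>: "\<And>s. s \<in> S \<Longrightarrow> \<eta> s > 0"
      "\<And>s. s \<in> S \<Longrightarrow> (\<eta> has_real_derivative - 1 / a) (at s within S)"
  shows "antiderivative_on S (\<lambda>s. 1 / (\<eta> s powr (3 / 2) + D)\<^sup>2)
    (\<lambda>s. - a *
      (1 / (9 * D powr (4/3))
         * ln ((\<eta> s - D powr (1/3) * (sqrt (\<eta> s) - D powr (1/3))) / (sqrt (\<eta> s) + D powr (1/3))\<^sup>2)
       + 2 / (3 * sqrt 3 * D powr (4/3))
         * (arctan ((2 * sqrt (\<eta> s) - D powr (1/3)) / (sqrt 3 * D powr (1/3)))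
            + sqrt 3 * \<eta> s / (D powr (-1/3) * \<eta> s powr (3/2) + D powr (2/3)))))"
  unfolding antiderivative_on_def
proof
  fix s assume s: "s \<in> S"
  define d where "d = D powr (1/3)"
  have d: "d > 0" using D by (simp add: d_def)
  have D_eq: "D = d ^ 3" "D powr (4/3) = d ^ 4" "D powr (2/3) = d\<^sup>2" "D powr (- (1/3)) = 1 / d"
    using D by (simp_all add: d_def powr_powr powr_minus field_simps flip: powr_realpow)
  define \<Phi> where "\<Phi> u = 1 / (9 * d ^ 4) * ln ((u\<^sup>2 - d * (u - d)) / (u + d)\<^sup>2)
      + 2 / (3 * sqrt 3 * d ^ 4) * (arctan ((2 * u - d) / (sqrt 3 * d))
        + sqrt 3 * u\<^sup>2 / (1 / d * u ^ 3 + d\<^sup>2))" for u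
  have q: "((\<lambda>s. sqrt (\<eta> s)) has_real_derivative - 1 / (2 * a * sqrt (\<eta> s))) (at s within S)"
    using \<eta>[OF s] a by (auto intro!: derivative_eq_intros simp: field_simps)
  have "((\<lambda>s. - a * \<Phi> (sqrt (\<eta> s))) has_real_derivative
      - a * (2 * sqrt (\<eta> s) / (sqrt (\<eta> s) ^ 3 + d ^ 3)\<^sup>2 * (- 1 / (2 * a * sqrt (\<eta> s))))) (at s within S)"
    unfolding \<Phi>_def
    by (intro DERIV_cmult DERIV_chain2[OF has_real_derivative_log_arctan_primitive q])
      (use d \<eta>(1)[OF s] in auto)
  moreover have "- a * (2 * sqrt (\<eta> s) / (sqrt (\<eta> s) ^ 3 + d ^ 3)\<^sup>2 * (- 1 / (2 * a * sqrt (\<eta> s))))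
      = 1 / (\<eta> s powr (3 / 2) + D)\<^sup>2"
    using a \<eta>(1)[OF s] by (simp add: powr_three_halves D_eq(1))
  ultimately have "((\<lambda>s. - a * \<Phi> (sqrt (\<eta> s))) has_real_derivative 1 / (\<eta> s powr (3 / 2) + D)\<^sup>2)
      (at s within S)"
    by simp
  then show "((\<lambda>s. - a *
      (1 / (9 * D powr (4/3))
         * ln ((\<eta> s - D powr (1/3) * (sqrt (\<eta> s) - D powr (1/3))) / (sqrt (\<eta> s) + D powr (1/3))\<^sup>2)
       + 2 / (3 * sqrt 3 * D powr (4/3))
         * (arctan ((2 * sqrt (\<eta> s) - D powr (1/3)) / (sqrt 3 * D powr (1/3)))
            + sqrt 3 * \<eta> s / (D powr (-1/3) * \<eta> s powr (3/2) + D powr (2/3)))))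
      has_real_derivative 1 / (\<eta> s powr (3 / 2) + D)\<^sup>2) (at s within S)"
    by (rule has_field_derivative_transform_within[where d = 1])
      (use s \<eta>(1) in \<open>auto simp: \<Phi>_def D_eq(2-4) powr_three_halves less_imp_le d_def[symmetric]\<close>)
qed

text \<open>Intervals are convex. This evaluates first integrals of the system at the initial
  parameter 0.\<close>

lemma has_real_derivative_zero_eq:
  fixes f :: "real \<Rightarrow> real"
  assumes "is_interval I" "\<And>s. s \<in> I \<Longrightarrow> (f has_real_derivative 0) (at s within I)" "p \<in> I" "q \<in> I"
  shows "f p = f q"
proof -
  have "convex I" using assms(1) by (simp add: is_interval_convex_1)
  then show ?thesis
    using has_field_derivative_zero_constant[of I f] assms by metis
qed

text \<open>The indefinite integral is rendered by a quantifier over all antiderivatives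
  \<open>G\<close>, with a constant depending on \<open>G\<close>; a separate existence claim keeps
  this from being vacuous. Since division is total, the denominators are asserted to be nonzero
  explicitly.\<close>

theorem proposition2p31:
  fixes a :: real
    and I :: "real set"
    and X :: "real \<Rightarrow> real^3"
    and \<alpha> \<tau> \<eta> :: "real \<Rightarrow> real"
  assumes "a > 0"
    and "0 \<in> I"
    and "arc_length_curve I X"
    and "\<forall>s\<in>I. X s \<in> light_cone_pos"
    and "\<forall>s\<in>I. velocity I X s = lorentz_cross (X s) (assoc_al I X s)"
    and "ICF_soliton I X"
    and "solves_system a I \<alpha> \<tau> \<eta>"
    and "(\<alpha> 0, \<tau> 0, \<eta> 0) \<in> cone_C"
    and "corresponds a I X \<alpha> \<tau> \<eta>"
  shows "let Y = assoc_al I X;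
             D = 3 / (2 * a) * ((3 * \<tau> 0 - 2 * a * (\<eta> 0)\<^sup>2) / (3 * sqrt (\<eta> 0)));
             I' = {s \<in> I. s < a * \<eta> 0};
             g = (\<lambda>s. 1 / (\<eta> s powr (3/2) + D)\<^sup>2)
         in CF_soliton I (\<lambda>s. - Y s)
          \<and> \<eta> 0 > 0
          \<and> (\<forall>s\<in>I'.
                X s = vector [- (((X s $ 3)\<^sup>2 + (\<alpha> s)\<^sup>2) / (2 * \<alpha> s)),
                              (- ((X s $ 3)\<^sup>2) + (\<alpha> s)\<^sup>2) / (2 * \<alpha> s),
                              X s $ 3]
              \<and> \<alpha> s = - ((\<tau> s)\<^sup>2 / (2 * \<eta> s))
              \<and> \<eta> s = - (s / a) + \<eta> 0
              \<and> Y s = vector [- (((Y s $ 3)\<^sup>2 + (\<eta> s)\<^sup>2) / (2 * \<eta> s)),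
                              (- ((Y s $ 3)\<^sup>2) + (\<eta> s)\<^sup>2) / (2 * \<eta> s),
                              Y s $ 3]
              \<and> \<tau> s = 2 * a * (\<eta> s)\<^sup>2 / 3
                      + sqrt (\<eta> s) * ((3 * \<tau> 0 - 2 * a * (\<eta> 0)\<^sup>2) / (3 * sqrt (\<eta> 0)))
              \<and> Y s $ 3 = (\<eta> s * X s $ 3 + \<tau> s) / \<alpha> s
              \<and> \<alpha> s \<noteq> 0 \<and> \<eta> s > 0 \<and> \<eta> s powr (3/2) + D \<noteq> 0)
          \<and> (\<exists>G. antiderivative_on I' g G)
          \<and> (\<forall>G. antiderivative_on I' g G \<longrightarrow>
                (\<exists>C\<^sub>0. \<forall>s\<in>I'. X s $ 3 = (\<eta> s powr (3/2) + D)\<^sup>2 * (- G s + C\<^sub>0)))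
          \<and> (D > 0 \<longrightarrow>
              antiderivative_on I' g
                (\<lambda>s. - a *
                  (1 / (9 * D powr (4/3))
                     * ln ((\<eta> s - D powr (1/3) * (sqrt (\<eta> s) - D powr (1/3)))
                           / (sqrt (\<eta> s) + D powr (1/3))\<^sup>2)
                   + 2 / (3 * sqrt 3 * D powr (4/3))
                     * (arctan ((2 * sqrt (\<eta> s) - D powr (1/3)) / (sqrt 3 * D powr (1/3)))
                        + sqrt 3 * \<eta> s
                          / (D powr (-1/3) * \<eta> s powr (3/2) + D powr (2/3))))))"
proof -
  define T Y where "T = velocity I X" and "Y = assoc_al I X"
  define c where "c = (3 * \<tau> 0 - 2 * a * (\<eta> 0)\<^sup>2) / (3 * sqrt (\<eta> 0))"
  define D where "D = 3 / (2 * a) * c"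
  define e :: "real^3" where "e = vector [1, 1, 0]"
  have a: "a > 0" by fact
  have int: "is_interval I"
    using assms(3) by (simp add: arc_length_curve_def spacelike_curve_def proper_interval_def)
  note frenet = arc_length_curveE[OF assms(3), folded T_def Y_def]
  have dX: "\<And>s. s \<in> I \<Longrightarrow> (X has_vector_derivative T s) (at s within I)"
    and gram: "\<And>s. s \<in> I \<Longrightarrow> mink (X s) (X s) = 0" "\<And>s. s \<in> I \<Longrightarrow> mink (Y s) (Y s) = 0"
      "\<And>s. s \<in> I \<Longrightarrow> mink (T s) (T s) = 1" "\<And>s. s \<in> I \<Longrightarrow> mink (X s) (Y s) = 1"
      "\<And>s. s \<in> I \<Longrightarrow> mink (T s) (X s) = 0" "\<And>s. s \<in> I \<Longrightarrow> mink (T s) (Y s) = 0"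
    by (rule frenet; blast)+
  have sys: "(\<alpha> has_real_derivative \<tau> s) (at s within I)"
    "(\<tau> has_real_derivative \<alpha> s / (a * \<tau> s) - \<eta> s) (at s within I)"
    "(\<eta> has_real_derivative - 1 / a) (at s within I)" if "s \<in> I" for s
    using assms(7) that by (auto simp: solves_system_def)
  have cor: "\<alpha> s = mink (X s) e" "\<tau> s = mink (T s) e" "\<eta> s = mink (Y s) e" "\<tau> s \<noteq> 0" if "s \<in> I" for s
    using assms(9) that by (auto simp: corresponds_def e_def T_def Y_def Let_def)

  \<comment> \<open>The cone relation and the signs of \<open>\<alpha>\<close> and
    \<open>\<eta>\<close>\<close>
  have e_eq: "e = \<eta> s *\<^sub>R X s + \<alpha> s *\<^sub>R Y s + \<tau> s *\<^sub>R T s" if s: "s \<in> I" for s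
    using pseudo_orthonormal_expansion[of "X s" "Y s" "T s" e] gram[OF s] cor[OF s]
    by (simp add: mink_commute)
  have quad: "2 * \<alpha> s * \<eta> s + (\<tau> s)\<^sup>2 = 0" if s: "s \<in> I" for s
  proof -
    \<comment> \<open>Expanding one argument of \<open>mink e e\<close> in the frame turns the
      lightlikeness of \<open>e\<close> into the cone relation at every \<open>s\<close>.\<close>
    have "0 = mink e e" by (simp add: e_def mink_def)
    also have "\<dots> = \<eta> s * \<alpha> s + \<alpha> s * \<eta> s + \<tau> s * \<tau> s"
      by (subst (1) e_eq[OF s]) (simp add: mink.add_left mink.scaleR_left cor[OF s])
    finally show ?thesis by (simp add: power2_eq_square)
  qed
  have \<alpha>_neg: "\<alpha> s < 0" and \<eta>_pos: "\<eta> s > 0" if s: "s \<in> I" for s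
  proof -
    \<comment> \<open>On the positive cone the first coordinate dominates, so
      \<open>\<alpha> s = X s $ 2 - X s $ 1\<close> is nonpositive. The cone relation and
      \<open>\<tau> s \<noteq> 0\<close> make \<open>\<alpha> s * \<eta> s\<close> strictly
      negative.\<close>
    have "(X s $ 1)\<^sup>2 = (X s $ 2)\<^sup>2 + (X s $ 3)\<^sup>2" "X s $ 1 > 0"
      using assms(4) s light_cone_posD by blast+
    then have "X s $ 2 \<le> X s $ 1" by (smt (verit) power2_le_imp_le zero_le_power2)
    then have "\<alpha> s \<le> 0" using cor(1)[OF s] by (simp add: e_def mink_def)
    moreover have "\<alpha> s * \<eta> s < 0"
    proof -
      have "2 * (\<alpha> s * \<eta> s) + (\<tau> s)\<^sup>2 = 0" using quad[OF s] by simp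
      moreover have "(\<tau> s)\<^sup>2 > 0" using cor(4)[OF s] by simp
      ultimately show ?thesis by linarith
    qed
    ultimately show "\<alpha> s < 0" "\<eta> s > 0" by (auto simp: mult_less_0_iff)
  qed

  \<comment> \<open>Closed forms of \<open>\<eta>\<close>, \<open>\<alpha>\<close> and
    \<open>\<tau>\<close>\<close>
  have \<eta>_eq: "\<eta> s = - (s / a) + \<eta> 0" if s: "s \<in> I" for s
  proof -
    have "\<eta> s + s / a = \<eta> 0 + 0 / a"
      by (rule has_real_derivative_zero_eq[OF int _ s \<open>0 \<in> I\<close>])
        (use a in \<open>auto intro!: derivative_eq_intros sys\<close>)
    then show ?thesis by simp
  qed
  \<comment> \<open>With the formula for \<open>\<eta>\<close>, positivity of
    \<open>\<eta> s\<close> says exactly \<open>s < a * \<eta> 0\<close>.\<close>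
  have I': "{s \<in> I. s < a * \<eta> 0} = I"
  proof -
    have "s < a * \<eta> 0" if "s \<in> I" for s
      using \<eta>_pos[OF that] \<eta>_eq[OF that] a by (simp add: field_simps)
    then show ?thesis by auto
  qed
  \<comment> \<open>In terms of \<open>q\<close> the half-integer powers of \<open>\<eta>\<close>
    become polynomial.\<close>
  define q where "q s = sqrt (\<eta> s)" for s
  have q: "q s > 0" "\<eta> s = (q s)\<^sup>2" if "s \<in> I" for s
    using \<eta>_pos[OF that] by (auto simp: q_def)
  have dq: "(q has_real_derivative - 1 / (2 * a * q s)) (at s within I)" if "s \<in> I" for s
    unfolding q_def using \<eta>_pos[OF that] a
    by (auto intro!: derivative_eq_intros sys that simp: field_simps)
  have \<alpha>_eq: "\<alpha> s = - ((\<tau> s)\<^sup>2 / (2 * \<eta> s))" if "s \<in> I" for s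
    using quad[OF that] \<eta>_pos[OF that] by (simp add: field_simps)
  have \<tau>_eq: "\<tau> s = 2 * a / 3 * q s ^ 4 + q s * c" if s: "s \<in> I" for s
  proof -
    \<comment> \<open>After \<open>\<alpha>\<close> is eliminated, \<open>q\<close> solves the
      homogeneous part of the linear equation for \<open>\<tau>\<close>, so
      \<open>\<tau> / q\<close> can be integrated. The constant obtained is
      \<open>c\<close>.\<close>
    have "((\<lambda>s. \<tau> s / q s - 2 * a / 3 * q s ^ 3) has_real_derivative 0) (at s within I)"
      if s: "s \<in> I" for s
    proof -
      have "\<alpha> s / (a * \<tau> s) = - \<tau> s / (2 * a * (q s)\<^sup>2)"
        using \<alpha>_eq[OF s] q[OF s] a cor(4)[OF s] by (simp add: field_simps power2_eq_square)
      then have "(\<tau> has_real_derivative - \<tau> s / (2 * a * (q s)\<^sup>2) - (q s)\<^sup>2) (at s within I)"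
        using sys(2)[OF s] q(2)[OF s] by simp
      then have "((\<lambda>s. \<tau> s / q s - 2 * a / 3 * q s ^ 3) has_real_derivative
          ((- \<tau> s / (2 * a * (q s)\<^sup>2) - (q s)\<^sup>2) * q s - \<tau> s * (- 1 / (2 * a * q s))) / (q s * q s)
          - 2 * a / 3 * (3 * (- 1 / (2 * a * q s) * (q s)\<^sup>2))) (at s within I)"
        using DERIV_power[OF dq[OF s], of 3] q(1)[OF s]
        by (intro DERIV_diff DERIV_divide DERIV_cmult dq[OF s]) (simp_all add: numeral_eq_Suc)
      moreover have "((- \<tau> s / (2 * a * (q s)\<^sup>2) - (q s)\<^sup>2) * q s - \<tau> s * (- 1 / (2 * a * q s))) / (q s * q s)
          - 2 * a / 3 * (3 * (- 1 / (2 * a * q s) * (q s)\<^sup>2)) = 0"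
        using q(1)[OF s] a by (simp add: field_simps power2_eq_square)
      ultimately show ?thesis by simp
    qed
    then have "\<tau> s / q s - 2 * a / 3 * q s ^ 3 = \<tau> 0 / q 0 - 2 * a / 3 * q 0 ^ 3"
      by (rule has_real_derivative_zero_eq[OF int _ s \<open>0 \<in> I\<close>])
    also have "\<dots> = c"
      using q[OF \<open>0 \<in> I\<close>] by (simp add: c_def q_def[symmetric] field_simps eval_nat_numeral)
    finally show ?thesis using q(1)[OF s] by (simp add: field_simps eval_nat_numeral)
  qed
  define P where "P s = q s ^ 3 + D" for s
  have P_powr: "\<eta> s powr (3 / 2) + D = P s" if "s \<in> I" for s
    using powr_three_halves[OF \<eta>_pos[OF that]] by (simp add: P_def q_def)
  have P_eq: "P s = 3 * \<tau> s / (2 * a * q s)" if s: "s \<in> I" for s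
    \<comment> \<open>Dividing the formula for \<open>\<tau> s\<close> by \<open>q s\<close> and
      scaling by \<open>3 / (2 * a)\<close> gives \<open>P s\<close>; thus \<open>P\<close> inherits
      its nonvanishing from \<open>\<tau>\<close>.\<close>
    using q(1)[OF s] a by (simp add: P_def D_def \<tau>_eq[OF s] field_simps eval_nat_numeral)
  have P0: "P s \<noteq> 0" if "s \<in> I" for s
    using P_eq[OF that] q(1)[OF that] a cor(4)[OF that] by simp

  \<comment> \<open>Third components of the frame and coordinates on the cone\<close>
  have Y3: "\<alpha> s * Y s $ 3 = \<eta> s * X s $ 3 + \<tau> s" if s: "s \<in> I" for s
  proof -
    have "T s = lorentz_cross (X s) (Y s)" using assms(5) s by (simp add: T_def Y_def)
    then have "\<tau> s = mink (lorentz_cross (X s) (Y s)) e" using cor(2)[OF s] by simp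
    also have "\<dots> = \<alpha> s * Y s $ 3 - \<eta> s * X s $ 3"
      unfolding cor(1)[OF s] cor(3)[OF s] by (simp add: e_def mink_def lorentz_cross_def algebra_simps)
    finally show ?thesis by simp
  qed
  have T3: "T s $ 3 = - 2 * \<eta> s * X s $ 3 / \<tau> s - 1" if s: "s \<in> I" for s
  proof -
    \<comment> \<open>The third component of \<open>e\<close> is 0, and \<open>Y3\<close> eliminates
      \<open>Y s $ 3\<close>.\<close>
    have "e $ 3 = \<eta> s * X s $ 3 + \<alpha> s * Y s $ 3 + \<tau> s * T s $ 3" by (subst e_eq[OF s]) simp
    then show ?thesis using Y3[OF s] cor(4)[OF s] by (simp add: e_def field_simps)
  qed
  have coords: "p = vector [- (((p $ 3)\<^sup>2 + b\<^sup>2) / (2 * b)), (- ((p $ 3)\<^sup>2) + b\<^sup>2) / (2 * b), p $ 3]"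
    if "mink p p = 0" "b = mink p e" "b \<noteq> 0" for p b
  proof -
    \<comment> \<open>On the cone \<open>(p $ 3)\<^sup>2 = - b * (p $ 1 + p $ 2)\<close>, so
      \<open>b\<close> and \<open>p $ 3\<close> determine both the sum and the difference of the
      first two coordinates.\<close>
    have b: "b = p $ 2 - p $ 1" using that(2) by (simp add: mink_def e_def)
    have p3: "(p $ 3)\<^sup>2 = (p $ 1)\<^sup>2 - (p $ 2)\<^sup>2"
      using that(1) by (simp add: mink_def power2_eq_square)
    show ?thesis
      using that(3) unfolding vec3_eq_iff p3 unfolding b
      by (simp add: field_simps power2_eq_square)
  qed

  \<comment> \<open>Integration of the third component of \<open>X\<close>\<close>
  define R where "R s = X s $ 3 / (P s)\<^sup>2" for s
  have dR: "(R has_real_derivative - (1 / (P s)\<^sup>2)) (at s within I)" if s: "s \<in> I" for s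
  proof -
    have dX3: "((\<lambda>s. X s $ 3) has_real_derivative T s $ 3) (at s within I)"
      using bounded_linear.has_vector_derivative[OF bounded_linear_vec_nth dX[OF s]]
      by (simp add: has_real_derivative_iff_has_vector_derivative)
    have "(P has_real_derivative 3 * (q s)\<^sup>2 * (- 1 / (2 * a * q s))) (at s within I)"
      unfolding P_def using dq[OF s] by (auto intro!: derivative_eq_intros)
    \<comment> \<open>The logarithmic derivative of \<open>P\<close> is
      \<open>- \<eta> / \<tau>\<close>, so \<open>P\<^sup>2\<close> solves the homogeneous part of
      the equation \<open>T3\<close> for \<open>X s $ 3\<close>. Variation of constants leaves
      \<open>R' = - 1 / P\<^sup>2\<close>.\<close>
    moreover have "3 * (q s)\<^sup>2 * (- 1 / (2 * a * q s)) = - \<eta> s * P s / \<tau> s"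
      using P_eq[OF s] q[OF s] a cor(4)[OF s] by (simp add: field_simps power2_eq_square)
    ultimately have dP: "(P has_real_derivative - \<eta> s * P s / \<tau> s) (at s within I)" by simp
    show ?thesis
      unfolding R_def
      by (rule derivative_eq_intros dX3 dP refl)+
        (use P0[OF s] cor(4)[OF s] in \<open>auto simp: T3[OF s] field_simps power2_eq_square eval_nat_numeral\<close>)
  qed
  have anti: "antiderivative_on I (\<lambda>s. 1 / (\<eta> s powr (3 / 2) + D)\<^sup>2) (\<lambda>s. - R s)"
    unfolding antiderivative_on_def
    using DERIV_minus[OF dR] P_powr by simp
  have X3: "\<exists>C\<^sub>0. \<forall>s\<in>I. X s $ 3 = (\<eta> s powr (3 / 2) + D)\<^sup>2 * (- G s + C\<^sub>0)"
    if G: "antiderivative_on I (\<lambda>s. 1 / (\<eta> s powr (3 / 2) + D)\<^sup>2) G" for G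
  proof (intro exI ballI)
    fix s assume s: "s \<in> I"
    \<comment> \<open>The derivatives of \<open>R\<close> and \<open>G\<close> are opposite, so
      their sum is constant; its value at 0 is the constant of integration.\<close>
    have RG: "R s + G s = R 0 + G 0"
    proof (rule has_real_derivative_zero_eq[OF int _ s \<open>0 \<in> I\<close>])
      fix s assume s: "s \<in> I"
      then have "(G has_real_derivative 1 / (P s)\<^sup>2) (at s within I)"
        using G P_powr by (simp add: antiderivative_on_def)
      from DERIV_add[OF dR[OF s] this]
      show "((\<lambda>s. R s + G s) has_real_derivative 0) (at s within I)" by simp
    qed
    have "- G s + (R 0 + G 0) = R s" using RG by simp
    moreover have "X s $ 3 = (P s)\<^sup>2 * R s" using P0[OF s] by (simp add: R_def)
    ultimately show "X s $ 3 = (\<eta> s powr (3 / 2) + D)\<^sup>2 * (- G s + (R 0 + G 0))"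
      using P_powr[OF s] by simp
  qed
  have pointwise: "X s = vector [- (((X s $ 3)\<^sup>2 + (\<alpha> s)\<^sup>2) / (2 * \<alpha> s)),
                              (- ((X s $ 3)\<^sup>2) + (\<alpha> s)\<^sup>2) / (2 * \<alpha> s), X s $ 3]
      \<and> \<alpha> s = - ((\<tau> s)\<^sup>2 / (2 * \<eta> s)) \<and> \<eta> s = - (s / a) + \<eta> 0
      \<and> Y s = vector [- (((Y s $ 3)\<^sup>2 + (\<eta> s)\<^sup>2) / (2 * \<eta> s)),
                      (- ((Y s $ 3)\<^sup>2) + (\<eta> s)\<^sup>2) / (2 * \<eta> s), Y s $ 3]
      \<and> \<tau> s = 2 * a * (\<eta> s)\<^sup>2 / 3 + sqrt (\<eta> s) * c
      \<and> Y s $ 3 = (\<eta> s * X s $ 3 + \<tau> s) / \<alpha> s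
      \<and> \<alpha> s \<noteq> 0 \<and> \<eta> s > 0 \<and> \<eta> s powr (3/2) + D \<noteq> 0" if s: "s \<in> I" for s
  proof (intro conjI \<alpha>_eq[OF s] \<eta>_eq[OF s] \<eta>_pos[OF s] coords[OF gram(1)[OF s] cor(1)[OF s]]
      coords[OF gram(2)[OF s] cor(3)[OF s]])
    show "\<tau> s = 2 * a * (\<eta> s)\<^sup>2 / 3 + sqrt (\<eta> s) * c"
      using \<tau>_eq[OF s] q[OF s] by (simp add: q_def[symmetric])
    show "Y s $ 3 = (\<eta> s * X s $ 3 + \<tau> s) / \<alpha> s"
      using Y3[OF s] \<alpha>_neg[OF s] by (simp add: field_simps)
    show "\<eta> s powr (3/2) + D \<noteq> 0" using P0[OF s] P_powr[OF s] by simp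
  qed (use \<alpha>_neg[OF s] \<eta>_pos[OF s] in simp_all)
  show ?thesis
    unfolding Let_def I' Y_def[symmetric] c_def[symmetric] D_def[symmetric]
    using CF_soliton_neg_assoc[OF assms(3,4,6)] \<eta>_pos[OF \<open>0 \<in> I\<close>] pointwise anti X3
      antiderivative_on_sqrt_cube[OF a _ \<eta>_pos sys(3), of D]
    unfolding Y_def[symmetric]
    by (intro conjI) blast+
qed

end
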